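(* It is not true that every isolated plane curve singularity $C$ satisfies $\mu^k(C)/\tau^k(C)<4/3$ for all $k\ge 0$: for $C=\{f=0\}$ with $f(x,y)=x^5+y^5+x^3y^3$, one has $\mu^8(C)=78$ and $\tau^8(C)=50$, so that $$\frac{\mu^8(C)}{\tau^8(C)}=\frac{78}{50}>\frac43.$$
   Context: $\mathcal{O}_2=\mathbb{C}\{x,y\}$ is the ring of germs of holomorphic functions at $0\in\mathbb{C}^2$ and $\mathfrak{m}$ is its maximal ideal. For $C=\{f=0\}$ with $f\in\mathcal{O}_2$ having an isolated singularity at $0$, $j(f)=\langle f_x,f_y\rangle$ and $k\ge0$, the $k$-th Milnor and $k$-th Tjurina numbers are $\mu^k(C)=\dim_{\mathbb{C}}\mathcal{O}_2/(\mathfrak{m}^k j(f))$ and $\tau^k(C)=\dim_{\mathbb{C}}\mathcal{O}_2/(\mathfrak{m}^k j(f)+\langle f\rangle)$. *)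

theory Defs
  imports "HOL-Analysis.Analysis"
    "HOL-Algebra.QuotRing" "HOL-Algebra.Ideal_Product" "HOL-Algebra.Embedded_Algebras"
begin

section \<open>Germs at the origin of the complex plane\<close>

text \<open>Germs at 0 of arbitrary functions of two complex variables; the holomorphic ones are singled
  out afterwards, as the carrier of the ring \<open>O2\<close>.\<close>

quotient_type germ = "complex \<times> complex \<Rightarrow> complex" /
  "\<lambda>F G. eventually (\<lambda>p. F p = G p) (nhds 0)"
proof (rule equivpI)
  show "reflp (\<lambda>F G::complex \<times> complex \<Rightarrow> complex. eventually (\<lambda>p. F p = G p) (nhds 0))"
    by (simp add: reflp_def)
  show "symp (\<lambda>F G::complex \<times> complex \<Rightarrow> complex. eventually (\<lambda>p. F p = G p) (nhds 0))"
    by (simp add: symp_def eq_commute)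
  show "transp (\<lambda>F G::complex \<times> complex \<Rightarrow> complex. eventually (\<lambda>p. F p = G p) (nhds 0))"
    unfolding transp_def by (auto elim: eventually_elim2)
qed

lift_definition germ_of :: "(complex \<times> complex \<Rightarrow> complex) \<Rightarrow> germ" is "\<lambda>F. F" .

instantiation germ :: comm_ring_1
begin

lift_definition zero_germ :: germ is "\<lambda>_. 0" .
lift_definition one_germ :: germ is "\<lambda>_. 1" .
lift_definition plus_germ :: "germ \<Rightarrow> germ \<Rightarrow> germ" is "\<lambda>F G p. F p + G p"
  by (auto elim: eventually_elim2)
lift_definition minus_germ :: "germ \<Rightarrow> germ \<Rightarrow> germ" is "\<lambda>F G p. F p - G p"
  by (auto elim: eventually_elim2)
lift_definition times_germ :: "germ \<Rightarrow> germ \<Rightarrow> germ" is "\<lambda>F G p. F p * G p"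
  by (auto elim: eventually_elim2)
lift_definition uminus_germ :: "germ \<Rightarrow> germ" is "\<lambda>F p. - F p"
  by (auto elim: eventually_mono)

instance
proof
  show "(0::germ) \<noteq> 1"
    by transfer (auto dest: eventually_nhds_x_imp_x)
qed (transfer; simp add: algebra_simps)+

end

lift_definition germ_at0 :: "germ \<Rightarrow> complex" is "\<lambda>F. F 0"
  by (rule eventually_nhds_x_imp_x)

definition germ_const :: "complex \<Rightarrow> germ" where
  "germ_const c = germ_of (\<lambda>_. c)"


section \<open>Partial derivatives\<close>

definition pderiv_x :: "(complex \<times> complex \<Rightarrow> complex) \<Rightarrow> complex \<times> complex \<Rightarrow> complex" where
  "pderiv_x F p = deriv (\<lambda>z. F (z, snd p)) (fst p)"

definition pderiv_y :: "(complex \<times> complex \<Rightarrow> complex) \<Rightarrow> complex \<times> complex \<Rightarrow> complex" where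
  "pderiv_y F p = deriv (\<lambda>w. F (fst p, w)) (snd p)"

lemma pderiv_cong_ev:
  fixes F G :: "complex \<times> complex \<Rightarrow> complex"
  assumes "eventually (\<lambda>q. F q = G q) (nhds p)"
  shows "pderiv_x F p = pderiv_x G p" and "pderiv_y F p = pderiv_y G p"
proof -
  have "((\<lambda>z. (z, snd p)) \<longlongrightarrow> (fst p, snd p)) (nhds (fst p))"
    by (intro tendsto_Pair tendsto_const) (simp add: filterlim_def)
  hence "eventually (\<lambda>z. F (z, snd p) = G (z, snd p)) (nhds (fst p))"
    using eventually_compose_filterlim[OF assms, of "\<lambda>z. (z, snd p)"] by simp
  thus "pderiv_x F p = pderiv_x G p"
    unfolding pderiv_x_def by (intro deriv_cong_ev refl)
  have "((\<lambda>w. (fst p, w)) \<longlongrightarrow> (fst p, snd p)) (nhds (snd p))"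
    by (intro tendsto_Pair tendsto_const) (simp add: filterlim_def)
  hence "eventually (\<lambda>w. F (fst p, w) = G (fst p, w)) (nhds (snd p))"
    using eventually_compose_filterlim[OF assms, of "\<lambda>w. (fst p, w)"] by simp
  thus "pderiv_y F p = pderiv_y G p"
    unfolding pderiv_y_def by (intro deriv_cong_ev refl)
qed

lemma eventually_pderiv_cong:
  fixes F G :: "complex \<times> complex \<Rightarrow> complex"
  assumes "eventually (\<lambda>q. F q = G q) (nhds p)"
  shows "eventually (\<lambda>q. pderiv_x F q = pderiv_x G q) (nhds p)"
    and "eventually (\<lambda>q. pderiv_y F q = pderiv_y G q) (nhds p)"
proof -
  have *: "eventually (\<lambda>r. eventually (\<lambda>q. F q = G q) (nhds r)) (nhds p)"
    using assms by (simp add: eventually_eventually)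
  show "eventually (\<lambda>q. pderiv_x F q = pderiv_x G q) (nhds p)"
    using * by eventually_elim (rule pderiv_cong_ev)
  show "eventually (\<lambda>q. pderiv_y F q = pderiv_y G q) (nhds p)"
    using * by eventually_elim (rule pderiv_cong_ev)
qed

lift_definition germ_dx :: "germ \<Rightarrow> germ" is pderiv_x
  by (rule eventually_pderiv_cong)

lift_definition germ_dy :: "germ \<Rightarrow> germ" is pderiv_y
  by (rule eventually_pderiv_cong)


section \<open>The local ring of holomorphic germs\<close>

text \<open>Holomorphy in two variables: complex (Frechet) differentiability, that is, the real derivative
  exists and is complex linear.\<close>

definition complex_differentiable2 ::
  "(complex \<times> complex \<Rightarrow> complex) \<Rightarrow> complex \<times> complex \<Rightarrow> bool" where
  "complex_differentiable2 F p \<longleftrightarrow>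
     (\<exists>a b. (F has_derivative (\<lambda>h. a * fst h + b * snd h)) (at p))"

lemma complex_differentiable2_cong_ev:
  assumes "eventually (\<lambda>q. F q = G q) (nhds p)"
  shows "complex_differentiable2 F p \<longleftrightarrow> complex_differentiable2 G p"
proof -
  have 1: "F p = G p" and 2: "eventually (\<lambda>q. F q = G q) (at p)"
    using assms by (auto simp: eventually_nhds_conv_at)
  have "(F has_derivative D) (at p) \<longleftrightarrow> (G has_derivative D) (at p)" for D
  proof
    show "(G has_derivative D) (at p)" if "(F has_derivative D) (at p)"
      by (rule has_derivative_transform_eventually[OF that 2 1]) simp
    show "(F has_derivative D) (at p)" if "(G has_derivative D) (at p)"
      using 2 by (intro has_derivative_transform_eventually[OF that])
        (auto simp: 1 elim: eventually_mono)
  qed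
  thus ?thesis
    unfolding complex_differentiable2_def by simp
qed

lift_definition germ_holomorphic :: "germ \<Rightarrow> bool" is
  "\<lambda>F. eventually (complex_differentiable2 F) (nhds 0)"
proof -
  fix F G :: "complex \<times> complex \<Rightarrow> complex"
  assume "eventually (\<lambda>p. F p = G p) (nhds 0)"
  hence "eventually (\<lambda>p. eventually (\<lambda>q. F q = G q) (nhds p)) (nhds 0)"
    by (simp add: eventually_eventually)
  hence "eventually (\<lambda>p. complex_differentiable2 F p \<longleftrightarrow> complex_differentiable2 G p) (nhds 0)"
    by eventually_elim (rule complex_differentiable2_cong_ev)
  thus "eventually (complex_differentiable2 F) (nhds 0) =
        eventually (complex_differentiable2 G) (nhds 0)"
    by (rule eventually_cong)
qed

definition O2 :: "germ ring" where
  "O2 = \<lparr>carrier = Collect germ_holomorphic, mult = (*), one = 1, zero = 0, add = (+)\<rparr>"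

definition max_ideal :: "germ set" where
  "max_ideal = {f \<in> carrier O2. germ_at0 f = 0}"

lemma complex_differentiable2_const: "complex_differentiable2 (\<lambda>_. c) p"
  unfolding complex_differentiable2_def
  by (intro exI[of _ 0]) simp

lemma complex_differentiable2_add:
  assumes "complex_differentiable2 F p" "complex_differentiable2 G p"
  shows "complex_differentiable2 (\<lambda>q. F q + G q) p"
proof -
  obtain a b c d where "(F has_derivative (\<lambda>h. a * fst h + b * snd h)) (at p)"
    "(G has_derivative (\<lambda>h. c * fst h + d * snd h)) (at p)"
    using assms unfolding complex_differentiable2_def by blast
  from has_derivative_add[OF this] show ?thesis
    unfolding complex_differentiable2_def
    by (intro exI[of _ "a + c"] exI[of _ "b + d"]) (simp add: algebra_simps)
qed

lemma complex_differentiable2_mult: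
  assumes "complex_differentiable2 F p" "complex_differentiable2 G p"
  shows "complex_differentiable2 (\<lambda>q. F q * G q) p"
proof -
  obtain a b c d where "(F has_derivative (\<lambda>h. a * fst h + b * snd h)) (at p)"
    "(G has_derivative (\<lambda>h. c * fst h + d * snd h)) (at p)"
    using assms unfolding complex_differentiable2_def by blast
  from has_derivative_mult[OF this] show ?thesis
    unfolding complex_differentiable2_def
    by (intro exI[of _ "F p * c + a * G p"] exI[of _ "F p * d + b * G p"]) (simp add: algebra_simps)
qed

lemma complex_differentiable2_inverse:
  assumes "complex_differentiable2 F p" "F p \<noteq> 0"
  shows "complex_differentiable2 (\<lambda>q. inverse (F q)) p"
proof -
  obtain a b where "(F has_derivative (\<lambda>h. a * fst h + b * snd h)) (at p)"
    using assms unfolding complex_differentiable2_def by blast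
  from Deriv.has_derivative_inverse[OF assms(2) this] show ?thesis
    unfolding complex_differentiable2_def
    by (intro exI[of _ "- (inverse (F p) * a * inverse (F p))"]
              exI[of _ "- (inverse (F p) * b * inverse (F p))"]) (simp add: algebra_simps)
qed

lemma complex_differentiable2_imp_isCont:
  "complex_differentiable2 F p \<Longrightarrow> isCont F p"
  unfolding complex_differentiable2_def by (auto dest: has_derivative_continuous)

lemma germ_holomorphic_const: "germ_holomorphic (germ_const c)"
  unfolding germ_const_def by transfer (rule always_eventually, simp add: complex_differentiable2_const)

lemma germ_holomorphic_0: "germ_holomorphic 0"
  by transfer (rule always_eventually, simp add: complex_differentiable2_const)

lemma germ_holomorphic_1: "germ_holomorphic 1"
  by transfer (rule always_eventually, simp add: complex_differentiable2_const)

lemma germ_holomorphic_add: "germ_holomorphic f \<Longrightarrow> germ_holomorphic g \<Longrightarrow> germ_holomorphic (f + g)"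
  by transfer (auto elim: eventually_elim2 intro: complex_differentiable2_add)

lemma germ_holomorphic_mult: "germ_holomorphic f \<Longrightarrow> germ_holomorphic g \<Longrightarrow> germ_holomorphic (f * g)"
  by transfer (auto elim: eventually_elim2 intro: complex_differentiable2_mult)

lemma germ_holomorphic_uminus: "germ_holomorphic f \<Longrightarrow> germ_holomorphic (- f)"
proof -
  assume "germ_holomorphic f"
  hence "germ_holomorphic (germ_const (-1) * f)"
    by (intro germ_holomorphic_mult germ_holomorphic_const)
  also have "germ_const (-1) * f = - f"
    unfolding germ_const_def by transfer simp
  finally show ?thesis .
qed

lemma germ_at0_simps:
  "germ_at0 0 = 0" "germ_at0 1 = 1" "germ_at0 (f + g) = germ_at0 f + germ_at0 g"
  "germ_at0 (f * g) = germ_at0 f * germ_at0 g" "germ_at0 (- f) = - germ_at0 f"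
  by (transfer; simp)+

lemma cring_O2: "cring O2"
proof (rule cringI)
  show "abelian_group O2"
  proof (rule abelian_groupI)
    fix x assume "x \<in> carrier O2"
    thus "\<exists>y\<in>carrier O2. y \<oplus>\<^bsub>O2\<^esub> x = \<zero>\<^bsub>O2\<^esub>"
      by (intro bexI[of _ "- x"]) (auto simp: O2_def germ_holomorphic_uminus)
  qed (auto simp: O2_def germ_holomorphic_0 germ_holomorphic_add add_ac)
  show "comm_monoid O2"
    by (rule comm_monoidI) (auto simp: O2_def germ_holomorphic_1 germ_holomorphic_mult mult_ac)
qed (auto simp: O2_def algebra_simps)

text \<open>A holomorphic germ that does not vanish at 0 is a unit, so \<open>max_ideal\<close> is the only
  maximal ideal.\<close>

lemma germ_inverse_exists:
  assumes "germ_holomorphic f" "germ_at0 f \<noteq> 0"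
  shows "\<exists>g. germ_holomorphic g \<and> f * g = 1"
  using assms
proof transfer
  fix F :: "complex \<times> complex \<Rightarrow> complex"
  assume F: "eventually (complex_differentiable2 F) (nhds 0)" "F 0 \<noteq> 0"
  have "isCont F 0"
    by (rule complex_differentiable2_imp_isCont[OF eventually_nhds_x_imp_x[OF F(1)]])
  hence "(F \<longlongrightarrow> F 0) (nhds 0)"
    by (simp add: isCont_def tendsto_at_iff_tendsto_nhds)
  hence ne: "eventually (\<lambda>p. F p \<noteq> 0) (nhds 0)"
    using F(2) by (rule tendsto_imp_eventually_ne)
  show "\<exists>G. eventually (complex_differentiable2 G) (nhds 0) \<and>
          eventually (\<lambda>p. F p * G p = 1) (nhds 0)"
  proof (intro exI[of _ "\<lambda>p. inverse (F p)"] conjI)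
    show "eventually (complex_differentiable2 (\<lambda>p. inverse (F p))) (nhds 0)"
      using F(1) ne by eventually_elim (rule complex_differentiable2_inverse)
    show "eventually (\<lambda>p. F p * inverse (F p) = 1) (nhds 0)"
      using ne by eventually_elim simp
  qed
qed

lemma ideal_max_ideal: "ideal max_ideal O2"
proof -
  interpret cring O2 by (rule cring_O2)
  have *: "\<ominus>\<^bsub>O2\<^esub> x = - x" if "x \<in> carrier O2" for x
    using that by (intro minus_equality) (auto simp: O2_def germ_holomorphic_uminus)
  show ?thesis
  proof (rule idealI[OF ring_axioms])
    show "subgroup max_ideal (add_monoid O2)"
    proof (rule add.subgroupI)
      show "max_ideal \<noteq> {}"
        using germ_holomorphic_0 by (auto simp: max_ideal_def O2_def germ_at0_simps)
    next
      fix a assume "a \<in> max_ideal"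
      thus "\<ominus>\<^bsub>O2\<^esub> a \<in> max_ideal"
        using * by (auto simp: max_ideal_def germ_at0_simps)
           (auto simp: O2_def germ_holomorphic_uminus)
    qed (auto simp: max_ideal_def O2_def germ_at0_simps germ_holomorphic_add)
  qed (auto simp: max_ideal_def O2_def germ_at0_simps germ_holomorphic_mult)
qed

lemma ideal_eq_carrier_or_subset_max_ideal:
  assumes "ideal J O2"
  shows "J = carrier O2 \<or> J \<subseteq> max_ideal"
proof (rule disjCI)
  assume "\<not> J \<subseteq> max_ideal"
  interpret J: ideal J O2 by fact
  obtain f where f: "f \<in> J" "germ_at0 f \<noteq> 0" "f \<in> carrier O2"
    using \<open>\<not> J \<subseteq> max_ideal\<close> J.Icarr unfolding max_ideal_def by blast
  obtain g where "germ_holomorphic g" "f * g = 1"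
    using germ_inverse_exists[of f] f by (auto simp: O2_def)
  with J.I_r_closed[OF f(1), of g] have "\<one>\<^bsub>O2\<^esub> \<in> J"
    by (simp add: O2_def)
  thus "J = carrier O2" by (rule J.one_imp_carrier)
qed

lemma maximalideal_iff: "maximalideal J O2 \<longleftrightarrow> J = max_ideal"
proof
  have ne: "carrier O2 \<noteq> max_ideal"
  proof
    assume "carrier O2 = max_ideal"
    hence "1 \<in> max_ideal"
      using germ_holomorphic_1 by (auto simp: O2_def)
    thus False by (simp add: max_ideal_def germ_at0_simps)
  qed
  show "J = max_ideal" if "maximalideal J O2"
  proof -
    interpret maximalideal J O2 by fact
    have "J \<subseteq> max_ideal"
      using ideal_eq_carrier_or_subset_max_ideal[OF is_ideal] I_notcarr by blast
    thus ?thesis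
      using I_maximal[OF ideal_max_ideal] ne by (auto simp: max_ideal_def)
  qed
  show "maximalideal J O2" if "J = max_ideal"
    unfolding that
  proof (rule maximalidealI[OF ideal_max_ideal ne])
    fix K assume "ideal K O2" "max_ideal \<subseteq> K"
    thus "K = max_ideal \<or> K = carrier O2"
      using ideal_eq_carrier_or_subset_max_ideal by blast
  qed
qed


section \<open>Isolated singularities and the higher Milnor and Tjurina numbers\<close>

text \<open>The origin is an isolated point of the locus where the germ and both of its partial
  derivatives vanish.\<close>

lift_definition isolated_singular_locus :: "germ \<Rightarrow> bool" is
  "\<lambda>F. eventually (\<lambda>p. \<not> (F p = 0 \<and> pderiv_x F p = 0 \<and> pderiv_y F p = 0)) (at 0)"
proof -
  fix F G :: "complex \<times> complex \<Rightarrow> complex"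
  assume FG: "eventually (\<lambda>p. F p = G p) (nhds 0)"
  have "eventually (\<lambda>p. (\<not> (F p = 0 \<and> pderiv_x F p = 0 \<and> pderiv_y F p = 0)) \<longleftrightarrow>
                        (\<not> (G p = 0 \<and> pderiv_x G p = 0 \<and> pderiv_y G p = 0))) (nhds 0)"
    using FG eventually_pderiv_cong[OF FG] by eventually_elim simp
  hence "eventually (\<lambda>p. (\<not> (F p = 0 \<and> pderiv_x F p = 0 \<and> pderiv_y F p = 0)) \<longleftrightarrow>
                        (\<not> (G p = 0 \<and> pderiv_x G p = 0 \<and> pderiv_y G p = 0))) (at 0)"
    by (auto simp: eventually_nhds_conv_at)
  thus "eventually (\<lambda>p. \<not> (F p = 0 \<and> pderiv_x F p = 0 \<and> pderiv_y F p = 0)) (at 0) =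
        eventually (\<lambda>p. \<not> (G p = 0 \<and> pderiv_x G p = 0 \<and> pderiv_y G p = 0)) (at 0)"
    by (rule eventually_cong)
qed

definition isolated_singularity :: "germ \<Rightarrow> bool" where
  "isolated_singularity f \<longleftrightarrow>
     f \<in> carrier O2 \<and>
     germ_at0 f = 0 \<and> germ_at0 (germ_dx f) = 0 \<and> germ_at0 (germ_dy f) = 0 \<and>
     isolated_singular_locus f"

text \<open>The partial derivatives of a holomorphic germ are again holomorphic (Cauchy's integral formula),
  so the two generators below belong to \<open>O2\<close>.\<close>

definition jacobian_ideal :: "germ \<Rightarrow> germ set" where
  "jacobian_ideal f = genideal O2 {germ_dx f, germ_dy f}"

definition milnor_ideal :: "nat \<Rightarrow> germ \<Rightarrow> germ set" where
  "milnor_ideal k f =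
     ideal_prod O2 (max_ideal [^]\<^bsub>ideals_set O2\<^esub> k) (jacobian_ideal f)"

definition tjurina_ideal :: "nat \<Rightarrow> germ \<Rightarrow> germ set" where
  "tjurina_ideal k f = milnor_ideal k f <+>\<^bsub>O2\<^esub> genideal O2 {f}"

text \<open>The complex numbers act on a quotient of \<open>O2\<close> through the classes of the constant germs. If the
  quotient is infinite-dimensional, the value is unspecified; for an isolated singularity all
  quotients below are finite-dimensional.\<close>

definition quotient_dim :: "germ set \<Rightarrow> nat" where
  "quotient_dim I =
     ring.dim (O2 Quot I) (range (\<lambda>c. I +>\<^bsub>O2\<^esub> germ_const c)) (carrier (O2 Quot I))"

definition milnor_number :: "nat \<Rightarrow> germ \<Rightarrow> nat" where
  "milnor_number k f = quotient_dim (milnor_ideal k f)"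

definition tjurina_number :: "nat \<Rightarrow> germ \<Rightarrow> nat" where
  "tjurina_number k f = quotient_dim (tjurina_ideal k f)"

end

theory Submission
  imports Defs "HOL-Complex_Analysis.Complex_Analysis"
begin

text \<open>
  The ideal \<open>m\<^sup>8 j(f)\<close> lies in \<open>m\<^sup>1\<^sup>2\<close>. Conversely
  \<open>(25 - 9xy) x\<^sup>p y\<^sup>q = 5 x\<^bsup>p-4\<^esup> y\<^sup>q f\<^sub>x - 3 x\<^bsup>p-2\<^esup> y\<^bsup>q-1\<^esup> f\<^sub>y\<close> with \<open>25 - 9xy\<close> a unit, so (together with
  the symmetric relation) \<open>m\<^sup>8 j(f)\<close> contains every monomial of degree 12 and equals \<open>m\<^sup>1\<^sup>2\<close>. Hence
  \<open>\<mu>\<^sup>8\<close> counts the monomials of degree below 12. Modulo \<open>m\<^sup>1\<^sup>2 + (f)\<close> the relation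
  \<open>x\<^sup>5 = f - y\<^sup>5 - x\<^sup>3 y\<^sup>3\<close> removes the monomials divisible by \<open>x\<^sup>5\<close>, and the remaining 50 are independent
  because the Taylor coefficients of a cofactor of \<open>f\<close> vanish one power of \<open>y\<close> after the other.

  Taylor coefficients of germs are handled algebraically, through the operators
  \<open>g \<mapsto> (g(x,y) - g(0,y)) / x\<close> and its mirror image. The analytic input is that these
  preserve holomorphy, which follows from Osgood's lemma.
\<close>

section \<open>Divided differences of holomorphic functions of two variables\<close>

text \<open>Cauchy's inequality turns uniform smallness of F(x,.) - F(a,.) near b into smallness of
  the y-derivative of that difference. The rest of the variation is that of the derivative of the
  single function F(a,.), which is holomorphic.\<close>

lemma continuous_on_pderiv_y:
  assumes A: "open A" and B: "open B" and cont: "continuous_on (A \<times> B) F"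
    and hol: "\<And>x. x \<in> A \<Longrightarrow> (\<lambda>w. F (x, w)) holomorphic_on B"
  shows "continuous_on (A \<times> B) (pderiv_y F)"
proof (rule continuous_at_imp_continuous_on, rule ballI)
  fix p assume "p \<in> A \<times> B"
  then obtain a b where p: "p = (a, b)" and a: "a \<in> A" and b: "b \<in> B" by auto
  obtain s where s: "s > 0" "cball a s \<subseteq> A" using A a open_contains_cball by blast
  obtain t' where t': "t' > 0" "cball b t' \<subseteq> B" using B b open_contains_cball by blast
  \<comment> \<open>Halving leaves room: for y within t of b, the Cauchy disc of radius t about y
    stays inside \<open>cball b (2 * t)\<close>.\<close>
  define t where "t = t' / 2"
  have t: "t > 0" "cball b (2 * t) \<subseteq> B" using t' by (auto simp: t_def)
  have "compact (cball a s \<times> cball b (2 * t))" by (intro compact_Times) auto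
  hence unif: "uniformly_continuous_on (cball a s \<times> cball b (2 * t)) F"
    by (rule compact_uniformly_continuous[rotated]) (rule continuous_on_subset[OF cont], use s t in auto)
  have dhol: "deriv (\<lambda>w. F (a, w)) holomorphic_on B"
    by (rule holomorphic_deriv[OF hol[OF a] B])
  hence dcont: "isCont (deriv (\<lambda>w. F (a, w))) b"
    using B b holomorphic_on_imp_continuous_on continuous_on_eq_continuous_at by blast
  show "isCont (pderiv_y F) p"
    unfolding continuous_at_eps_delta
  proof (intro allI impI)
    fix e :: real assume e: "e > 0"
    \<comment> \<open>The bound e/2 * t becomes e/2 after the division by t in Cauchy's
      inequality.\<close>
    obtain d1 where d1: "d1 > 0" "\<And>q q'. q \<in> cball a s \<times> cball b (2 * t) \<Longrightarrow>
        q' \<in> cball a s \<times> cball b (2 * t) \<Longrightarrow> dist q' q < d1 \<Longrightarrow> dist (F q') (F q) < e / 2 * t"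
      using unif e t(1) unfolding uniformly_continuous_on_def
      by (metis half_gt_zero mult_pos_pos)
    obtain d2 where d2: "d2 > 0" "\<And>y. dist y b < d2 \<Longrightarrow>
        dist (deriv (\<lambda>w. F (a, w)) y) (deriv (\<lambda>w. F (a, w)) b) < e / 2"
      using dcont e unfolding continuous_at_eps_delta by (metis half_gt_zero)
    define d where "d = min (min d1 d2) (min s t)"
    have "d > 0" using d1 d2 s t by (simp add: d_def)
    moreover have "dist (pderiv_y F q) (pderiv_y F p) < e" if "dist q p < d" for q
    proof -
      obtain x y where q: "q = (x, y)" by (cases q)
      have xa: "dist x a < d" and yb: "dist y b < d"
        using that dist_fst_le[of q p] dist_snd_le[of q p] by (auto simp: p q)
      have xs: "x \<in> cball a s" using xa by (simp add: d_def dist_commute)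
      have sub: "cball y t \<subseteq> cball b (2 * t)"
      proof
        fix w assume "w \<in> cball y t"
        thus "w \<in> cball b (2 * t)"
          using yb dist_triangle[of b w y] by (simp add: d_def dist_commute)
      qed
      have hx: "(\<lambda>w. F (x, w)) holomorphic_on cball b (2 * t)"
        and ha: "(\<lambda>w. F (a, w)) holomorphic_on cball b (2 * t)"
        using holomorphic_on_subset[OF hol t(2)] a xs s by blast+
      have hd: "(\<lambda>w. F (x, w) - F (a, w)) holomorphic_on cball y t"
        by (rule holomorphic_on_subset[OF _ sub]) (intro holomorphic_intros hx ha)
      have "norm ((deriv ^^ 1) (\<lambda>w. F (x, w) - F (a, w)) y) \<le> fact 1 * (e / 2 * t) / t ^ 1"
      proof (rule Cauchy_inequality)
        show "(\<lambda>w. F (x, w) - F (a, w)) holomorphic_on ball y t"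
          using hd by (rule holomorphic_on_subset) auto
        show "continuous_on (cball y t) (\<lambda>w. F (x, w) - F (a, w))"
          using hd by (rule holomorphic_on_imp_continuous_on)
        fix w assume "norm (y - w) = t"
        hence "w \<in> cball y t" by (simp add: dist_norm)
        hence "w \<in> cball b (2 * t)" using sub by blast
        hence "dist (F (x, w)) (F (a, w)) < e / 2 * t"
          using xs s xa by (intro d1(2)) (auto simp: dist_Pair_Pair d_def)
        thus "norm (F (x, w) - F (a, w)) \<le> e / 2 * t" by (simp add: dist_norm)
      qed (use t in auto)
      moreover have "y \<in> cball y t"
        using t by simp
      hence "y \<in> B" "x \<in> A"
        using sub t(2) s(2) xs by blast+
      hence "deriv (\<lambda>w. F (x, w) - F (a, w)) y = pderiv_y F q - deriv (\<lambda>w. F (a, w)) y"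
        unfolding pderiv_y_def q fst_conv snd_conv
        by (intro deriv_diff holomorphic_on_imp_differentiable_at[OF hol B] a)
      ultimately have "dist (pderiv_y F q) (deriv (\<lambda>w. F (a, w)) y) \<le> e / 2"
        using t by (simp add: dist_norm)
      moreover have "dist (deriv (\<lambda>w. F (a, w)) y) (pderiv_y F p) < e / 2"
        using d2(2)[of y] yb by (simp add: d_def p pderiv_y_def)
      ultimately show ?thesis
        using dist_triangle[of "pderiv_y F q" "pderiv_y F p" "deriv (\<lambda>w. F (a, w)) y"] by simp
    qed
    ultimately show "\<exists>d>0. \<forall>q. dist q p < d \<longrightarrow> dist (pderiv_y F q) (pderiv_y F p) < e"
      by blast
  qed
qed

lemma continuous_on_swap:
  assumes "continuous_on (A \<times> B) F"
  shows "continuous_on (B \<times> A) (\<lambda>p. F (prod.swap p))"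
  using assms by (rule continuous_on_compose2) (auto intro!: continuous_intros simp: prod.swap_def)

lemma continuous_on_pderiv_x:
  assumes A: "open A" and B: "open B" and cont: "continuous_on (A \<times> B) F"
    and hol: "\<And>y. y \<in> B \<Longrightarrow> (\<lambda>z. F (z, y)) holomorphic_on A"
  shows "continuous_on (A \<times> B) (pderiv_x F)"
proof -
  have "continuous_on (B \<times> A) (pderiv_y (\<lambda>p. F (prod.swap p)))"
    by (rule continuous_on_pderiv_y[OF B A continuous_on_swap[OF cont]]) (use hol in auto)
  from continuous_on_swap[OF this] show ?thesis
    by (simp add: pderiv_x_def pderiv_y_def[abs_def] prod.swap_def)
qed

text \<open>Osgood's lemma. A partial derivative in x at the point together with a continuous
  partial derivative in y gives the total derivative, and both partials act by multiplication with
  complex numbers, so the total derivative is complex linear.\<close>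

lemma separately_holomorphic_imp_complex_differentiable2:
  assumes A: "open A" and B: "open B" and cont: "continuous_on (A \<times> B) F"
    and holx: "\<And>y. y \<in> B \<Longrightarrow> (\<lambda>z. F (z, y)) holomorphic_on A"
    and holy: "\<And>x. x \<in> A \<Longrightarrow> (\<lambda>w. F (x, w)) holomorphic_on B"
    and p: "p \<in> A \<times> B"
  shows "complex_differentiable2 F p"
proof -
  obtain a b where ab: "p = (a, b)" "a \<in> A" "b \<in> B" using p by auto
  obtain s where s: "s > 0" "ball b s \<subseteq> B" using B ab open_contains_ball by blast
  have cont': "isCont (pderiv_y F) p"
    using continuous_on_pderiv_y[OF A B cont holy] p open_Times[OF A B]
    by (auto simp: continuous_on_eq_continuous_at)
  have 1: "((\<lambda>z. F (z, b)) has_derivative (*) (deriv (\<lambda>z. F (z, b)) a)) (at a within A)"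
    unfolding has_field_derivative_def[symmetric]
    by (rule has_field_derivative_at_within) (rule holomorphic_derivI[OF holx[OF ab(3)] A ab(2)])
  \<comment> \<open>\<open>has_derivative_partialsI\<close> wants the second partial as a continuous
    family of bounded linear maps over a convex set, hence \<open>blinfun_mult_right\<close> and a
    ball instead of B.\<close>
  have 2: "((\<lambda>w. F (x, w)) has_derivative blinfun_apply (blinfun_mult_right (pderiv_y F (x, y))))
            (at y within ball b s)" if "x \<in> A" "y \<in> ball b s" for x y
  proof -
    have "((\<lambda>w. F (x, w)) has_field_derivative pderiv_y F (x, y)) (at y)"
      unfolding pderiv_y_def using holomorphic_derivI[OF holy[OF that(1)] B, of y] that s by auto
    from has_field_derivative_at_within[OF this] show ?thesis
      by (simp add: has_field_derivative_def blinfun_mult_right.rep_eq)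
  qed
  have 3: "continuous (at (a, b) within A \<times> ball b s) (\<lambda>(x, y). blinfun_mult_right (pderiv_y F (x, y)))"
    using bounded_linear.continuous[OF bounded_linear_blinfun_mult_right
        continuous_at_imp_continuous_at_within[OF cont']]
    by (simp add: ab split_beta')
  have "((\<lambda>(x, y). F (x, y)) has_derivative
     (\<lambda>(tx, ty). deriv (\<lambda>z. F (z, b)) a * tx + blinfun_mult_right (pderiv_y F (a, b)) ty))
     (at (a, b) within A \<times> ball b s)"
    by (rule has_derivative_partialsI[OF 1 2 3]) (use s in auto)
  moreover have "(a, b) \<in> A \<times> ball b s" "open (A \<times> ball b s)"
    using ab s A by (auto intro: open_Times)
  note at_within_open[OF this]
  ultimately have "((\<lambda>(x, y). F (x, y)) has_derivative
     (\<lambda>(tx, ty). deriv (\<lambda>z. F (z, b)) a * tx + pderiv_y F (a, b) * ty)) (at (a, b))"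
    by (simp only: blinfun_mult_right.rep_eq)
  thus ?thesis
    unfolding complex_differentiable2_def ab split_beta' prod.collapse by blast
qed

lemma complex_differentiable2_imp_field_differentiable:
  assumes "complex_differentiable2 F (x, y)"
  shows "(\<lambda>z. F (z, y)) field_differentiable at x"
    and "(\<lambda>w. F (x, w)) field_differentiable at y"
proof -
  obtain a b where F: "(F has_derivative (\<lambda>h. a * fst h + b * snd h)) (at (x, y))"
    using assms unfolding complex_differentiable2_def by blast
  have "((\<lambda>z. (z, y)) has_derivative (\<lambda>h. (h, 0))) (at x)"
    by (auto intro!: derivative_eq_intros)
  from has_derivative_compose[OF this F] have "((\<lambda>z. F (z, y)) has_field_derivative a) (at x)"
    by (simp add: has_field_derivative_def)
  thus "(\<lambda>z. F (z, y)) field_differentiable at x"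
    unfolding field_differentiable_def by blast
  have "((\<lambda>w. (x, w)) has_derivative (\<lambda>h. (0, h))) (at y)"
    by (auto intro!: derivative_eq_intros)
  from has_derivative_compose[OF this F] have "((\<lambda>w. F (x, w)) has_field_derivative b) (at y)"
    by (simp add: has_field_derivative_def)
  thus "(\<lambda>w. F (x, w)) field_differentiable at y"
    unfolding field_differentiable_def by blast
qed

lemma complex_differentiable2_imp_holomorphic:
  assumes "\<And>p. p \<in> A \<times> B \<Longrightarrow> complex_differentiable2 F p"
  shows "y \<in> B \<Longrightarrow> (\<lambda>z. F (z, y)) holomorphic_on A"
    and "x \<in> A \<Longrightarrow> (\<lambda>w. F (x, w)) holomorphic_on B"
  unfolding holomorphic_on_def
  by (auto intro!: field_differentiable_at_within complex_differentiable2_imp_field_differentiable assms)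

section \<open>The difference quotient in x, with the removable singularity along x = 0 filled
  in\<close>

definition diff_quot_x :: "(complex \<times> complex \<Rightarrow> complex) \<Rightarrow> complex \<times> complex \<Rightarrow> complex" where
  "diff_quot_x F p =
     (if fst p = 0 then pderiv_x F (0, snd p) else (F p - F (0, snd p)) / fst p)"

text \<open>Off the line x = 0 this is a quotient of continuous functions. On that line the mean
  value inequality compares the quotient with the value of \<open>pderiv_x F\<close> at p, using
  that \<open>pderiv_x F\<close> is continuous there.\<close>

lemma isCont_diff_quot_x:
  assumes A: "open A" and B: "open B" and A0: "0 \<in> A" and cont: "continuous_on (A \<times> B) F"
    and hol: "\<And>y. y \<in> B \<Longrightarrow> (\<lambda>z. F (z, y)) holomorphic_on A"
    and p: "p \<in> A \<times> B"
  shows "isCont (diff_quot_x F) p"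
proof (cases "fst p = 0")
  case False
  have "eventually (\<lambda>q. (F q - F (0, snd q)) / fst q = diff_quot_x F q) (nhds p)"
  proof -
    have "eventually (\<lambda>q. fst q \<noteq> 0) (nhds p)"
      by (rule tendsto_imp_eventually_ne[OF _ False]) 
        (rule tendsto_fst[OF filterlim_ident])
    thus ?thesis by eventually_elim (simp add: diff_quot_x_def)
  qed
  moreover have "isCont (\<lambda>q. (F q - F (0, snd q)) / fst q) p"
  proof -
    have o: "open (A \<times> B)" using A B by (rule open_Times)
    have c: "isCont F q" if "q \<in> A \<times> B" for q
      using cont that unfolding continuous_on_eq_continuous_at[OF o] by blast
    have "isCont (\<lambda>q::complex \<times> complex. (0::complex, snd q)) p"
      by (intro continuous_intros)
    moreover have "isCont F (0, snd p)"
      using p A0 by (intro c) auto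
    ultimately have "isCont (\<lambda>q. F (0, snd q)) p"
      by (rule isCont_o2)
    thus ?thesis using c[OF p] False by (intro continuous_intros)
  qed
  ultimately show ?thesis
    using isCont_cong[of "\<lambda>q. (F q - F (0, snd q)) / fst q" "diff_quot_x F" p] by blast
next
  case True
  then obtain b where b: "p = (0, b)" "b \<in> B" using p by (cases p) auto
  have "isCont (pderiv_x F) p"
    using continuous_on_pderiv_x[OF A B cont hol] p open_Times[OF A B]
    by (auto simp: continuous_on_eq_continuous_at)
  show ?thesis
    unfolding continuous_at_eps_delta
  proof (intro allI impI)
    fix e :: real assume e: "e > 0"
    obtain s where s: "s > 0" "ball 0 s \<subseteq> A" using A A0 open_contains_ball by blast
    obtain t where t: "t > 0" "ball b t \<subseteq> B" using B b open_contains_ball by blast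
    obtain d1 where d1: "d1 > 0" "\<And>q. dist q p < d1 \<Longrightarrow> dist (pderiv_x F q) (pderiv_x F p) < e / 2"
      using \<open>isCont (pderiv_x F) p\<close> e unfolding continuous_at_eps_delta by (metis half_gt_zero)
    define d where "d = min d1 (min s t)"
    have "d > 0" using d1 s t by (simp add: d_def)
    moreover have "dist (diff_quot_x F q) (diff_quot_x F p) < e" if q: "dist q p < d" for q
    proof -
      obtain x y where xy: "q = (x, y)" by (cases q)
      have x: "norm x < d" and y: "dist y b < d"
        using q dist_fst_le[of q p] dist_snd_le[of q p] by (auto simp: xy b)
      have yB: "y \<in> B" using y t by (auto simp: d_def dist_commute)
      \<comment> \<open>The whole disc of radius |x| in the slice at height y is no further from p
        than q is, so one bound serves for every point of it.\<close>
      have near: "dist (pderiv_x F (z, y)) (pderiv_x F p) < e / 2" if "norm z \<le> norm x" for z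
      proof (rule d1(2))
        have "dist (z, y) p \<le> dist q p"
          using that by (simp add: b xy dist_Pair_Pair real_sqrt_le_mono power_mono)
        thus "dist (z, y) p < d1" using q by (simp add: d_def)
      qed
      define D where "D = pderiv_x F p"
      show ?thesis
      proof (cases "x = 0")
        case True
        thus ?thesis using near[of 0] e by (simp add: diff_quot_x_def xy b)
      next
        case False
        \<comment> \<open>Subtracting the linear function D*z leaves a function of z with derivative
          at most e/2 on the disc; its increment from 0 to x is x times the difference to be
          bounded.\<close>
        have "norm ((F (x, y) - D * x) - (F (0, y) - D * 0)) \<le> e / 2 * norm (x - 0)"
        proof (rule field_differentiable_bound[of "cball 0 (norm x)"])
          fix z :: complex assume z: "z \<in> cball 0 (norm x)"
          hence "z \<in> A" using x s by (auto simp: d_def)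
          hence "((\<lambda>z. F (z, y)) has_field_derivative pderiv_x F (z, y)) (at z)"
            unfolding pderiv_x_def using holomorphic_derivI[OF hol[OF yB] A] by simp
          thus "((\<lambda>z. F (z, y) - D * z) has_field_derivative pderiv_x F (z, y) - D)
             (at z within cball 0 (norm x))"
            using DERIV_cmult_Id[of D z]
            by (intro has_field_derivative_at_within[OF DERIV_diff])
          show "norm (pderiv_x F (z, y) - D) \<le> e / 2"
            using near[of z] z by (simp add: D_def dist_norm)
        qed auto
        moreover have "(F (x, y) - D * x) - (F (0, y) - D * 0) = x * (diff_quot_x F q - diff_quot_x F p)"
          using False by (simp add: diff_quot_x_def xy b D_def field_simps)
        ultimately have "norm x * norm (diff_quot_x F q - diff_quot_x F p) \<le> norm x * (e / 2)"
          by (simp add: norm_mult mult.commute)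
        hence "norm (diff_quot_x F q - diff_quot_x F p) \<le> e / 2"
          using False by simp
        thus ?thesis using e by (simp add: dist_norm)
      qed
    qed
    ultimately show "\<exists>d>0. \<forall>q. dist q p < d \<longrightarrow> dist (diff_quot_x F q) (diff_quot_x F p) < e"
      by blast
  qed
qed

text \<open>By Osgood's lemma separate holomorphy suffices. In x it is the removable singularity
  theorem; in y it is immediate for x nonzero, and the slice x = 0 is a locally uniform limit of
  such slices.\<close>

lemma complex_differentiable2_diff_quot_x:
  assumes A: "open A" and B: "open B" and A0: "0 \<in> A"
    and F: "\<And>p. p \<in> A \<times> B \<Longrightarrow> complex_differentiable2 F p" and p: "p \<in> A \<times> B"
  shows "complex_differentiable2 (diff_quot_x F) p"
proof -
  note hol = complex_differentiable2_imp_holomorphic[of A B F, OF F]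
  have cont: "continuous_on (A \<times> B) F"
    by (rule continuous_at_imp_continuous_on) (use F complex_differentiable2_imp_isCont in blast)
  have iC: "isCont (diff_quot_x F) q" if "q \<in> A \<times> B" for q
    by (rule isCont_diff_quot_x[OF A B A0 cont hol(1) that])
  have contQ: "continuous_on (A \<times> B) (diff_quot_x F)"
    using iC by (intro continuous_at_imp_continuous_on) auto
  have x: "(\<lambda>z. diff_quot_x F (z, y)) holomorphic_on A" if "y \<in> B" for y
    using pole_lemma_open[OF hol(1)[OF _ that] A, of 0]
    by (simp add: diff_quot_x_def pderiv_x_def cong: if_cong)
  have y0: "(\<lambda>w. diff_quot_x F (x, w)) holomorphic_on B" if "x \<in> A" "x \<noteq> 0" for x
  proof -
    have "(\<lambda>w. (F (x, w) - F (0, w)) / x) holomorphic_on B"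
      using that by (intro holomorphic_intros hol(2) A0) auto
    thus ?thesis using that by (simp add: diff_quot_x_def)
  qed
  have y: "(\<lambda>w. diff_quot_x F (x, w)) holomorphic_on B" if xA: "x \<in> A" for x
  proof (cases "x = 0")
    case False
    thus ?thesis using y0 xA by blast
  next
    case True
    obtain s where s: "s > 0" "cball 0 s \<subseteq> A" using A A0 open_contains_cball by blast
    \<comment> \<open>Any sequence of nonzero points of the disc tending to 0 would do; it selects
      slices already known to be holomorphic.\<close>
    define \<xi> :: "nat \<Rightarrow> complex" where "\<xi> n = of_real (s / real (Suc n))" for n
    have \<xi>: "\<xi> n \<in> cball 0 s" "\<xi> n \<noteq> 0" for n
    proof -
      show "\<xi> n \<noteq> 0" using s by (simp add: \<xi>_def del: of_nat_Suc)
      have "s / real (Suc n) \<le> s / 1" using s by (intro divide_left_mono) auto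
      thus "\<xi> n \<in> cball 0 s" using s by (simp add: \<xi>_def norm_divide del: of_nat_Suc)
    qed
    have \<xi>_lim: "\<xi> \<longlonglongrightarrow> 0"
    proof -
      have "(\<lambda>n. s * inverse (real (Suc n))) \<longlonglongrightarrow> s * 0"
        by (intro tendsto_mult tendsto_const LIMSEQ_inverse_real_of_nat)
      hence "(\<lambda>n. complex_of_real (s * inverse (real (Suc n)))) \<longlonglongrightarrow> of_real (s * 0)"
        by (rule tendsto_of_real)
      thus ?thesis by (simp add: \<xi>_def[abs_def] divide_inverse)
    qed
    have "(\<lambda>w. diff_quot_x F (0, w)) holomorphic_on B"
    proof (rule holomorphic_uniform_sequence[OF B, where f = "\<lambda>n w. diff_quot_x F (\<xi> n, w)"])
      show "(\<lambda>w. diff_quot_x F (\<xi> n, w)) holomorphic_on B" for n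
        using y0 \<xi> s by blast
      fix b assume "b \<in> B"
      then obtain t where t: "t > 0" "cball b t \<subseteq> B" using B open_contains_cball by blast
      have "compact (cball (0::complex) s \<times> cball b t)" by (intro compact_Times) auto
      hence unif: "uniformly_continuous_on (cball 0 s \<times> cball b t) (diff_quot_x F)"
        by (rule compact_uniformly_continuous[rotated])
          (rule continuous_on_subset[OF contQ], use s t in auto)
      \<comment> \<open>Uniform continuity of the quotient on the compact product makes the
        convergence uniform in w.\<close>
      have "uniform_limit (cball b t) (\<lambda>n w. diff_quot_x F (\<xi> n, w))
          (\<lambda>w. diff_quot_x F (0, w)) sequentially"
      proof (rule uniform_limitI)
        fix e :: real assume "e > 0"
        then obtain d where d: "d > 0" "\<And>q q'. q \<in> cball 0 s \<times> cball b t \<Longrightarrow>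
          q' \<in> cball 0 s \<times> cball b t \<Longrightarrow> dist q' q < d \<Longrightarrow>
          dist (diff_quot_x F q') (diff_quot_x F q) < e"
          using unif unfolding uniformly_continuous_on_def by metis
        have "eventually (\<lambda>n. dist (\<xi> n) 0 < d) sequentially"
          using \<xi>_lim d(1) by (rule tendstoD)
        thus "eventually (\<lambda>n. \<forall>w\<in>cball b t. dist (diff_quot_x F (\<xi> n, w)) (diff_quot_x F (0, w)) < e)
          sequentially"
        proof eventually_elim
          case (elim n)
          show ?case
          proof
            fix w assume w: "w \<in> cball b t"
            have "dist (\<xi> n, w) (0, w) < d" using elim by (simp add: dist_Pair_Pair)
            thus "dist (diff_quot_x F (\<xi> n, w)) (diff_quot_x F (0, w)) < e"
              using w \<xi>(1)[of n] s by (intro d(2)) auto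
          qed
        qed
      qed
      thus "\<exists>d>0. cball b d \<subseteq> B \<and> uniform_limit (cball b d) (\<lambda>n w. diff_quot_x F (\<xi> n, w))
          (\<lambda>w. diff_quot_x F (0, w)) sequentially"
        using t by blast
    qed
    thus ?thesis using True by simp
  qed
  show ?thesis
    by (rule separately_holomorphic_imp_complex_differentiable2[OF A B contQ x y p])
qed

section \<open>Taylor coefficients of germs\<close>

lemma eventually_nhds_0_E:
  fixes P :: "complex \<times> complex \<Rightarrow> bool"
  assumes "eventually P (nhds 0)"
  obtains A B where "open A" "open B" "0 \<in> A" "0 \<in> B" "\<And>p. p \<in> A \<times> B \<Longrightarrow> P p"
proof -
  obtain S where S: "open S" "0 \<in> S" "\<And>p. p \<in> S \<Longrightarrow> P p"
    using assms unfolding eventually_nhds by blast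
  obtain A B where "open A" "open B" "(0, 0) \<in> A \<times> B" "A \<times> B \<subseteq> S"
    using open_prod_elim[OF S(1,2)] by (metis zero_prod_def)
  thus ?thesis using S(3) that[of A B] by blast
qed

lemma eventually_nhds_0_restr:
  fixes P :: "complex \<times> complex \<Rightarrow> bool"
  assumes "eventually P (nhds 0)"
  shows "eventually (\<lambda>p. P (0, snd p)) (nhds (0 :: complex \<times> complex))"
proof -
  have "isCont (\<lambda>p::complex \<times> complex. (0::complex, snd p)) 0"
    by (intro continuous_intros)
  hence "((\<lambda>p::complex \<times> complex. (0::complex, snd p)) \<longlongrightarrow> 0) (nhds 0)"
    using tendsto_at_iff_tendsto_nhds[of "\<lambda>p::complex \<times> complex. (0::complex, snd p)" 0]
    by (simp add: isCont_def zero_prod_def)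
  from eventually_compose_filterlim[OF assms this] show ?thesis .
qed

lemma eventually_nhds_0_swap:
  fixes P :: "complex \<times> complex \<Rightarrow> bool"
  assumes "eventually P (nhds 0)"
  shows "eventually (\<lambda>p. P (prod.swap p)) (nhds (0 :: complex \<times> complex))"
proof -
  have "isCont (\<lambda>p::complex \<times> complex. prod.swap p) 0"
    unfolding prod.swap_def by (intro continuous_intros)
  hence "((\<lambda>p::complex \<times> complex. prod.swap p) \<longlongrightarrow> 0) (nhds 0)"
    using tendsto_at_iff_tendsto_nhds[of "\<lambda>p::complex \<times> complex. prod.swap p" 0]
    by (simp add: isCont_def zero_prod_def)
  from eventually_compose_filterlim[OF assms this] show ?thesis .
qed

section \<open>Coordinate germs, swap, restriction to the y-axis and the shift operators\<close>

lift_definition germ_X :: germ is fst .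
lift_definition germ_Y :: germ is snd .

lift_definition germ_swap :: "germ \<Rightarrow> germ" is "\<lambda>F p. F (prod.swap p)"
  by (rule eventually_nhds_0_swap)

lift_definition germ_restr :: "germ \<Rightarrow> germ" is "\<lambda>F p. F (0, snd p)"
  by (rule eventually_nhds_0_restr)

lift_definition germ_sx :: "germ \<Rightarrow> germ" is diff_quot_x
proof -
  fix F G :: "complex \<times> complex \<Rightarrow> complex"
  assume ev: "\<forall>\<^sub>F p in nhds 0. F p = G p"
  show "\<forall>\<^sub>F p in nhds 0. diff_quot_x F p = diff_quot_x G p"
    \<comment> \<open>The quotient at p also looks at F and its x-derivative at (0, y), so agreement
      near 0 has to be transported along the projection to the y-axis.\<close>
    using ev eventually_nhds_0_restr[OF ev] eventually_nhds_0_restr[OF eventually_pderiv_cong(1)[OF ev]]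
    by eventually_elim (simp add: diff_quot_x_def)
qed

text \<open>Conjugating by the swap lets every rule for \<open>germ_sy\<close> be inherited from
  \<open>germ_sx\<close>.\<close>

definition germ_sy :: "germ \<Rightarrow> germ" where
  "germ_sy g = germ_swap (germ_sx (germ_swap g))"

lemma germ_swap_simps [simp]:
  "germ_swap (g + h) = germ_swap g + germ_swap h"
  "germ_swap (g * h) = germ_swap g * germ_swap h"
  "germ_swap (germ_swap g) = g"
  "germ_swap germ_X = germ_Y" "germ_swap germ_Y = germ_X"
  "germ_swap (germ_const c) = germ_const c"
  "germ_at0 (germ_swap g) = germ_at0 g"
  unfolding germ_const_def by (transfer; simp add: prod.swap_def zero_prod_def)+

lemma germ_const_simps:
  "germ_const 0 = 0" "germ_const 1 = 1"
  "germ_const (a + b) = germ_const a + germ_const b"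
  "germ_const (a * b) = germ_const a * germ_const b"
  "germ_const (- a) = - germ_const a"
  unfolding germ_const_def by (transfer; simp)+

lemma germ_at0_X_Y_const [simp]:
  "germ_at0 germ_X = 0" "germ_at0 germ_Y = 0" "germ_at0 (germ_const c) = c"
  unfolding germ_const_def by (transfer; simp)+

text \<open>The numbers a, b, c, d are the entries of the complex matrix of L, which keep the
  composite derivative complex linear. The instances needed are the swap and the projection to the
  y-axis.\<close>

lemma complex_differentiable2_compose_linear:
  assumes "complex_differentiable2 F (L p)" and "bounded_linear L"
    and "\<And>h. fst (L h) = a * fst h + b * snd h" "\<And>h. snd (L h) = c * fst h + d * snd h"
  shows "complex_differentiable2 (\<lambda>q. F (L q)) p"
proof -
  obtain m n where F: "(F has_derivative (\<lambda>h. m * fst h + n * snd h)) (at (L p))"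
    using assms unfolding complex_differentiable2_def by blast
  from has_derivative_compose[OF bounded_linear_imp_has_derivative[OF assms(2)] this]
  show ?thesis
    unfolding complex_differentiable2_def assms(3,4)
    by (intro exI[of _ "m * a + n * c"] exI[of _ "m * b + n * d"]) (simp add: algebra_simps)
qed

lemma germ_holomorphic_X [simp, intro]: "germ_holomorphic germ_X"
proof transfer
  have "complex_differentiable2 fst p" for p
    unfolding complex_differentiable2_def
    by (rule exI[of _ 1], rule exI[of _ 0]) (simp add: bounded_linear_fst bounded_linear_imp_has_derivative)
  thus "eventually (complex_differentiable2 fst) (nhds 0)"
    by (intro always_eventually allI)
qed

lemma germ_holomorphic_swap:
  assumes "germ_holomorphic g"
  shows "germ_holomorphic (germ_swap g)"
  using assms
proof transfer
  fix F :: "complex \<times> complex \<Rightarrow> complex"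
  assume "eventually (complex_differentiable2 F) (nhds 0)"
  from eventually_nhds_0_swap[OF this]
  show "eventually (complex_differentiable2 (\<lambda>p. F (prod.swap p))) (nhds 0)"
  proof eventually_elim
    case (elim p)
    have "bounded_linear (prod.swap :: complex \<times> complex \<Rightarrow> _)"
      unfolding prod.swap_def by (intro bounded_linear_Pair bounded_linear_snd bounded_linear_fst)
    from complex_differentiable2_compose_linear[OF elim this, of 0 1 1 0] show ?case
      by simp
  qed
qed

lemma germ_holomorphic_Y [simp, intro]: "germ_holomorphic germ_Y"
  using germ_holomorphic_swap[OF germ_holomorphic_X] by simp

lemma germ_holomorphic_restr:
  assumes "germ_holomorphic g"
  shows "germ_holomorphic (germ_restr g)"
  using assms
proof transfer
  fix F :: "complex \<times> complex \<Rightarrow> complex"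
  assume "eventually (complex_differentiable2 F) (nhds 0)"
  from eventually_nhds_0_restr[OF this]
  show "eventually (complex_differentiable2 (\<lambda>p. F (0, snd p))) (nhds 0)"
  proof eventually_elim
    case (elim p)
    have "bounded_linear (\<lambda>p :: complex \<times> complex. (0::complex, snd p))"
      by (intro bounded_linear_Pair bounded_linear_snd bounded_linear_zero)
    from complex_differentiable2_compose_linear[OF elim this, of 0 0 0 1] show ?case
      by simp
  qed
qed

lemma germ_holomorphic_sx:
  assumes "germ_holomorphic g"
  shows "germ_holomorphic (germ_sx g)"
  using assms
proof transfer
  fix F :: "complex \<times> complex \<Rightarrow> complex"
  assume "eventually (complex_differentiable2 F) (nhds 0)"
  then obtain A B where AB: "open A" "open B" "0 \<in> A" "0 \<in> B"
    "\<And>p. p \<in> A \<times> B \<Longrightarrow> complex_differentiable2 F p"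
    using eventually_nhds_0_E by blast
  have "open (A \<times> B)" "0 \<in> A \<times> B"
    using AB by (auto simp: zero_prod_def intro: open_Times)
  thus "eventually (complex_differentiable2 (diff_quot_x F)) (nhds 0)"
    unfolding eventually_nhds
    by (intro exI[of _ "A \<times> B"] conjI ballI)
      (assumption | rule complex_differentiable2_diff_quot_x[OF AB(1,2,3,5)])+
qed

lemma germ_holomorphic_sy: "germ_holomorphic g \<Longrightarrow> germ_holomorphic (germ_sy g)"
  unfolding germ_sy_def by (intro germ_holomorphic_swap germ_holomorphic_sx)

lemma germ_holomorphic_diff: "germ_holomorphic g \<Longrightarrow> germ_holomorphic h \<Longrightarrow> germ_holomorphic (g - h)"
  using germ_holomorphic_add[of g "- h"] germ_holomorphic_uminus[of h] by simp

lemma germ_holomorphic_power: "germ_holomorphic g \<Longrightarrow> germ_holomorphic (g ^ n)"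
  by (induction n) (auto intro: germ_holomorphic_1 germ_holomorphic_mult)

lemma germ_holomorphic_sum:
  "(\<And>s. s \<in> S \<Longrightarrow> germ_holomorphic (g s)) \<Longrightarrow> germ_holomorphic (sum g S)"
  by (induction S rule: infinite_finite_induct)
    (auto intro: germ_holomorphic_0 germ_holomorphic_add)

lemmas germ_holomorphic_intros =
  germ_holomorphic_0 germ_holomorphic_1 germ_holomorphic_const germ_holomorphic_add
  germ_holomorphic_diff germ_holomorphic_uminus germ_holomorphic_mult germ_holomorphic_power
  germ_holomorphic_sum germ_holomorphic_sx germ_holomorphic_sy

text \<open>True pointwise: where x = 0, the filled-in value is multiplied by 0.\<close>

lemma germ_restr_plus_X_sx: "germ_restr g + germ_X * germ_sx g = g"
  by transfer (rule always_eventually, auto simp: diff_quot_x_def)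

text \<open>Hadamard's lemma: split off a multiple of X, then split the restriction to the y-axis in
  the same way in y. It drives both the generation of the maximal ideal by X, Y and the expansion
  into monomials.\<close>

lemma germ_hadamard:
  "g = germ_const (germ_at0 g) + germ_X * germ_sx g + germ_Y * germ_sy (germ_restr g)"
proof -
  define r where "r = germ_restr g"
  \<comment> \<open>The splitting in y is the splitting in x of the swapped germ, swapped
    back.\<close>
  have "r = germ_swap (germ_restr (germ_swap r) + germ_X * germ_sx (germ_swap r))"
    by (simp only: germ_restr_plus_X_sx germ_swap_simps)
  also have "\<dots> = germ_swap (germ_restr (germ_swap r)) + germ_Y * germ_sy r"
    by (simp add: germ_sy_def)
  also have "germ_swap (germ_restr (germ_swap r)) = germ_const (germ_at0 g)"
    unfolding germ_const_def r_def by transfer (simp add: zero_prod_def)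
  finally have "r = germ_const (germ_at0 g) + germ_Y * germ_sy r" .
  hence "r + germ_X * germ_sx g = germ_const (germ_at0 g) + germ_X * germ_sx g + germ_Y * germ_sy r"
    by (simp add: add_ac)
  thus ?thesis
    unfolding r_def germ_restr_plus_X_sx .
qed

text \<open>Where x = 0 the quotient is a derivative, so additivity needs differentiability at (0,
  y); that is why holomorphy is transported to the y-axis.\<close>

lemma germ_sx_add:
  assumes "germ_holomorphic g" "germ_holomorphic h"
  shows "germ_sx (g + h) = germ_sx g + germ_sx h"
  using assms
proof transfer
  fix F G :: "complex \<times> complex \<Rightarrow> complex"
  assume "eventually (complex_differentiable2 F) (nhds 0)" "eventually (complex_differentiable2 G) (nhds 0)"
  from this[THEN eventually_nhds_0_restr]
  show "\<forall>\<^sub>F p in nhds 0. diff_quot_x (\<lambda>p. F p + G p) p = diff_quot_x F p + diff_quot_x G p"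
  proof eventually_elim
    case (elim p)
    thus ?case
      using deriv_add[OF elim[THEN complex_differentiable2_imp_field_differentiable(1)]]
      by (simp add: diff_quot_x_def pderiv_x_def add_divide_distrib diff_divide_distrib)
  qed
qed

text \<open>A factor independent of x passes through the quotient. The uses are the factor Y and
  constants.\<close>

lemma germ_sx_restr_mult:
  assumes "germ_holomorphic g"
  shows "germ_sx (germ_restr h * g) = germ_restr h * germ_sx g"
  using assms
proof transfer
  fix F G :: "complex \<times> complex \<Rightarrow> complex"
  assume "eventually (complex_differentiable2 F) (nhds 0)"
  from eventually_nhds_0_restr[OF this]
  show "\<forall>\<^sub>F p in nhds 0. diff_quot_x (\<lambda>p. G (0, snd p) * F p) p = G (0, snd p) * diff_quot_x F p"
  proof eventually_elim
    case (elim p)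
    thus ?case
      using deriv_cmult[OF elim[THEN complex_differentiable2_imp_field_differentiable(1)]]
      by (simp add: diff_quot_x_def pderiv_x_def right_diff_distrib)
  qed
qed

text \<open>Since X*g vanishes on the y-axis, the quotient cancels X; at x = 0 the product rule
  gives the same value.\<close>

lemma germ_sx_X_mult:
  assumes "germ_holomorphic g"
  shows "germ_sx (germ_X * g) = g"
  using assms
proof transfer
  fix F :: "complex \<times> complex \<Rightarrow> complex"
  assume "eventually (complex_differentiable2 F) (nhds 0)"
  from eventually_nhds_0_restr[OF this]
  show "\<forall>\<^sub>F p in nhds 0. diff_quot_x (\<lambda>p. fst p * F p) p = F p"
  proof eventually_elim
    case (elim p)
    have "deriv (\<lambda>z. z * F (z, snd p)) 0 = F (0, snd p)"
      using deriv_mult[OF field_differentiable_ident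
          elim[THEN complex_differentiable2_imp_field_differentiable(1)]] by simp
    thus ?case
      by (cases p) (auto simp: diff_quot_x_def pderiv_x_def)
  qed
qed

lemma germ_restr_simps [simp]:
  "germ_restr germ_Y = germ_Y" "germ_restr (germ_const c) = germ_const c"
  unfolding germ_const_def by (transfer; simp)+

lemma germ_sx_const: "germ_sx (germ_const c) = 0"
  unfolding germ_const_def
  by transfer (simp add: diff_quot_x_def pderiv_x_def)

lemma germ_sx_Y_mult: "germ_holomorphic g \<Longrightarrow> germ_sx (germ_Y * g) = germ_Y * germ_sx g"
  using germ_sx_restr_mult[of g germ_Y] by simp

lemma germ_sx_const_mult: "germ_holomorphic g \<Longrightarrow> germ_sx (germ_const c * g) = germ_const c * germ_sx g"
  using germ_sx_restr_mult[of g "germ_const c"] by simp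

lemma germ_sy_simps:
  shows "germ_sy (germ_const c) = 0"
    and "germ_holomorphic g \<Longrightarrow> germ_sy (germ_Y * g) = g"
    and "germ_holomorphic g \<Longrightarrow> germ_sy (germ_X * g) = germ_X * germ_sy g"
    and "germ_holomorphic g \<Longrightarrow> germ_sy (germ_const c * g) = germ_const c * germ_sy g"
    and "germ_holomorphic g \<Longrightarrow> germ_holomorphic h \<Longrightarrow> germ_sy (g + h) = germ_sy g + germ_sy h"
proof -
  have "germ_swap 0 = 0" by transfer simp
  thus "germ_sy (germ_const c) = 0" by (simp add: germ_sy_def germ_sx_const)
qed (simp_all add: germ_sy_def germ_holomorphic_swap germ_sx_X_mult germ_sx_Y_mult
       germ_sx_const_mult germ_sx_add)

text \<open>The Taylor coefficient of x^i y^j: each \<open>germ_sx\<close> or \<open>germ_sy\<close>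
  drops the terms free of its variable and lowers that exponent by one, so the wanted coefficient
  ends up as the value at 0. This form needs no power series.\<close>

definition germ_coeff :: "germ \<Rightarrow> nat \<Rightarrow> nat \<Rightarrow> complex" where
  "germ_coeff g i j = germ_at0 ((germ_sy ^^ j) ((germ_sx ^^ i) g))"

lemma germ_holomorphic_funpow:
  assumes "germ_holomorphic g"
  shows "germ_holomorphic ((germ_sx ^^ i) g)" and "germ_holomorphic ((germ_sy ^^ i) g)"
  by (induction i) (use assms in \<open>auto intro: germ_holomorphic_sx germ_holomorphic_sy\<close>)

lemma germ_coeff_add:
  assumes "germ_holomorphic g" "germ_holomorphic h"
  shows "germ_coeff (g + h) i j = germ_coeff g i j + germ_coeff h i j"
proof -
  have "(germ_sx ^^ i) (g + h) = (germ_sx ^^ i) g + (germ_sx ^^ i) h"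
    by (induction i) (simp_all add: assms germ_holomorphic_funpow germ_sx_add)
  moreover have "(germ_sy ^^ j) (u + v) = (germ_sy ^^ j) u + (germ_sy ^^ j) v"
    if "germ_holomorphic u" "germ_holomorphic v" for u v
    by (induction j) (simp_all add: that germ_holomorphic_funpow germ_sy_simps)
  ultimately show ?thesis
    by (simp add: germ_coeff_def assms germ_holomorphic_funpow germ_at0_simps)
qed

lemma germ_coeff_const_mult:
  assumes "germ_holomorphic g"
  shows "germ_coeff (germ_const c * g) i j = c * germ_coeff g i j"
proof -
  have "(germ_sx ^^ i) (germ_const c * g) = germ_const c * (germ_sx ^^ i) g"
    by (induction i) (simp_all add: assms germ_holomorphic_funpow germ_sx_const_mult)
  moreover have "(germ_sy ^^ j) (germ_const c * u) = germ_const c * (germ_sy ^^ j) u"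
    if "germ_holomorphic u" for u
    by (induction j) (simp_all add: that germ_holomorphic_funpow germ_sy_simps)
  ultimately show ?thesis
    by (simp add: germ_coeff_def assms germ_holomorphic_funpow germ_at0_simps)
qed

text \<open>For i = 0 the factor X commutes with every \<open>germ_sy\<close> and kills the value at
  0; otherwise the innermost \<open>germ_sx\<close> cancels it.\<close>

lemma germ_coeff_X_mult:
  assumes "germ_holomorphic g"
  shows "germ_coeff (germ_X * g) i j = (if i = 0 then 0 else germ_coeff g (i - 1) j)"
proof (cases i)
  case 0
  have "(germ_sy ^^ j) (germ_X * g) = germ_X * (germ_sy ^^ j) g"
    by (induction j) (simp_all add: assms germ_holomorphic_funpow germ_sy_simps)
  thus ?thesis by (simp add: germ_coeff_def 0 germ_at0_simps)
next
  case (Suc k)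
  thus ?thesis by (simp add: germ_coeff_def funpow_Suc_right germ_sx_X_mult assms del: funpow.simps)
qed

lemma germ_coeff_Y_mult:
  assumes "germ_holomorphic g"
  shows "germ_coeff (germ_Y * g) i j = (if j = 0 then 0 else germ_coeff g i (j - 1))"
proof -
  have *: "(germ_sx ^^ i) (germ_Y * g) = germ_Y * (germ_sx ^^ i) g"
    by (induction i) (simp_all add: assms germ_holomorphic_funpow germ_sx_Y_mult)
  show ?thesis
  proof (cases j)
    case 0
    thus ?thesis by (simp add: germ_coeff_def * germ_at0_simps)
  next
    case (Suc k)
    thus ?thesis
      by (simp add: germ_coeff_def * funpow_Suc_right germ_sy_simps germ_holomorphic_funpow assms
          del: funpow.simps)
  qed
qed

lemma germ_coeff_1: "germ_coeff 1 i j = (if i = 0 \<and> j = 0 then 1 else 0)"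
proof -
  have x: "germ_sx 0 = 0" "germ_sx 1 = 0" and y: "germ_sy 0 = 0" "germ_sy 1 = 0"
    using germ_sx_const[of 0] germ_sx_const[of 1] germ_sy_simps(1)[of 0] germ_sy_simps(1)[of 1]
    by (simp_all add: germ_const_simps)
  have 0: "(germ_sx ^^ k) 0 = 0" "(germ_sy ^^ k) 0 = 0" for k
    by (induction k) (simp_all add: x y)
  show ?thesis
    by (cases i; cases j) (simp_all add: germ_coeff_def funpow_Suc_right x y 0 germ_at0_simps del: funpow.simps(2))
qed

lemma germ_coeff_monom_mult:
  assumes "germ_holomorphic g"
  shows "germ_coeff (germ_X ^ a * germ_Y ^ b * g) i j =
           (if a \<le> i \<and> b \<le> j then germ_coeff g (i - a) (j - b) else 0)"
proof -
  have Y: "germ_coeff (germ_Y ^ b * g) i j = (if b \<le> j then germ_coeff g i (j - b) else 0)" for i j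
  proof (induction b arbitrary: j)
    case (Suc b)
    have "germ_coeff (germ_Y * (germ_Y ^ b * g)) i j =
        (if j = 0 then 0 else germ_coeff (germ_Y ^ b * g) i (j - 1))"
      by (intro germ_coeff_Y_mult germ_holomorphic_intros assms germ_holomorphic_Y)
    thus ?case by (auto simp: Suc mult.assoc)
  qed simp
  have "germ_coeff (germ_X ^ a * (germ_Y ^ b * g)) i j =
      (if a \<le> i then germ_coeff (germ_Y ^ b * g) (i - a) j else 0)" for i
  proof (induction a arbitrary: i)
    case (Suc a)
    have "germ_coeff (germ_X * (germ_X ^ a * (germ_Y ^ b * g))) i j =
        (if i = 0 then 0 else germ_coeff (germ_X ^ a * (germ_Y ^ b * g)) (i - 1) j)"
      by (intro germ_coeff_X_mult germ_holomorphic_intros assms germ_holomorphic_X germ_holomorphic_Y)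
    thus ?case by (auto simp: Suc mult.assoc)
  qed simp
  thus ?thesis by (simp add: Y mult.assoc)
qed

lemma germ_coeff_sum:
  assumes "\<And>s. s \<in> S \<Longrightarrow> germ_holomorphic (g s)"
  shows "germ_coeff (sum g S) i j = (\<Sum>s\<in>S. germ_coeff (g s) i j)"
proof -
  have z: "germ_coeff 0 i j = 0"
    using germ_coeff_const_mult[of 1 0 i j] by (simp add: germ_const_simps germ_holomorphic_1)
  show ?thesis
    using assms
    by (induction S rule: infinite_finite_induct)
      (simp_all add: z germ_coeff_add germ_holomorphic_sum)
qed

section \<open>Powers of the maximal ideal and dimensions of quotients\<close>

lemma O2_simps [simp]:
  "x \<in> carrier O2 \<longleftrightarrow> germ_holomorphic x"
  "x \<otimes>\<^bsub>O2\<^esub> y = x * y" "x \<oplus>\<^bsub>O2\<^esub> y = x + y" "\<one>\<^bsub>O2\<^esub> = 1" "\<zero>\<^bsub>O2\<^esub> = 0"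
  by (simp_all add: O2_def)

lemma O2_a_inv: "germ_holomorphic x \<Longrightarrow> \<ominus>\<^bsub>O2\<^esub> x = - x"
proof -
  interpret cring O2 by (rule cring_O2)
  assume "germ_holomorphic x"
  thus ?thesis by (intro minus_equality) (auto simp: germ_holomorphic_uminus)
qed

lemma O2_idealD:
  assumes "ideal I O2"
  shows "g \<in> I \<Longrightarrow> germ_holomorphic g" "0 \<in> I"
    "g \<in> I \<Longrightarrow> h \<in> I \<Longrightarrow> g + h \<in> I" "g \<in> I \<Longrightarrow> h \<in> I \<Longrightarrow> g - h \<in> I"
    "germ_holomorphic h \<Longrightarrow> g \<in> I \<Longrightarrow> h * g \<in> I" "germ_holomorphic h \<Longrightarrow> g \<in> I \<Longrightarrow> g * h \<in> I"
proof -
  interpret ideal I O2 by fact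
  show hol: "germ_holomorphic g" if "g \<in> I" for g using Icarr[OF that] by simp
  show "0 \<in> I" using additive_subgroup.zero_closed[OF ideal.axioms(1)[OF assms]] by simp
  show add: "g + h \<in> I" if "g \<in> I" "h \<in> I" for g h using additive_subgroup.a_closed[OF ideal.axioms(1)[OF assms] that] by simp
  show "h * g \<in> I" if "germ_holomorphic h" "g \<in> I" for g h
    using I_l_closed[OF that(2), of h] that by simp
  show "g * h \<in> I" if "germ_holomorphic h" "g \<in> I" for g h
    using I_r_closed[OF that(2), of h] that by simp
  show "g - h \<in> I" if "g \<in> I" "h \<in> I" for g h
    using add[OF that(1) I_l_closed[OF that(2), of "- 1"]]
    by (simp add: germ_holomorphic_1 germ_holomorphic_uminus)
qed

lemma O2_unit_mult_mem_ideal: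
  assumes "ideal I O2" "germ_holomorphic u" "germ_at0 u \<noteq> 0" "germ_holomorphic g" "u * g \<in> I"
  shows "g \<in> I"
proof -
  obtain v where v: "germ_holomorphic v" "u * v = 1"
    using germ_inverse_exists assms by blast
  have "v * (u * g) \<in> I" by (rule O2_idealD(5)[OF assms(1) v(1) assms(5)])
  also have "v * (u * g) = (u * v) * g" by (simp only: mult_ac)
  finally show ?thesis using v by simp
qed

text \<open>A model of the powers of the maximal ideal that allows induction on the exponent;
  \<open>max_ideal_power\<close> identifies the two.\<close>

primrec mpow :: "nat \<Rightarrow> germ set" where
  "mpow 0 = Collect germ_holomorphic"
| "mpow (Suc n) = {germ_X * g + germ_Y * h | g h. g \<in> mpow n \<and> h \<in> mpow n}"

lemma mpow_SucI: "g \<in> mpow n \<Longrightarrow> h \<in> mpow n \<Longrightarrow> germ_X * g + germ_Y * h \<in> mpow (Suc n)"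
  by auto

lemma mpow_SucE:
  assumes "u \<in> mpow (Suc n)"
  obtains g h where "u = germ_X * g + germ_Y * h" "g \<in> mpow n" "h \<in> mpow n"
  using assms by auto

lemma mpow_holomorphic: "g \<in> mpow n \<Longrightarrow> germ_holomorphic g"
  by (induction n arbitrary: g)
    (auto intro!: germ_holomorphic_add germ_holomorphic_mult)

lemma mpow_0: "0 \<in> mpow n"
proof (induction n)
  case (Suc n)
  from mpow_SucI[OF Suc Suc] show ?case by simp
qed (simp add: germ_holomorphic_0)

lemma mpow_add: "g \<in> mpow n \<Longrightarrow> h \<in> mpow n \<Longrightarrow> g + h \<in> mpow n"
proof (induction n arbitrary: g h)
  case (Suc n)
  obtain a b c d where "g = germ_X * a + germ_Y * b" "h = germ_X * c + germ_Y * d"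
    and "a \<in> mpow n" "b \<in> mpow n" "c \<in> mpow n" "d \<in> mpow n"
    using Suc.prems by (auto elim!: mpow_SucE)
  moreover from this have "germ_X * (a + c) + germ_Y * (b + d) \<in> mpow (Suc n)"
    by (intro mpow_SucI Suc.IH)
  ultimately show ?case by (simp only: algebra_simps)
qed (simp add: germ_holomorphic_add)

lemma mpow_mult: "g \<in> mpow n \<Longrightarrow> germ_holomorphic h \<Longrightarrow> h * g \<in> mpow n"
proof (induction n arbitrary: g)
  case (Suc n)
  obtain a b where "g = germ_X * a + germ_Y * b" "a \<in> mpow n" "b \<in> mpow n"
    using Suc.prems by (auto elim!: mpow_SucE)
  moreover from this have "germ_X * (h * a) + germ_Y * (h * b) \<in> mpow (Suc n)"
    by (intro mpow_SucI Suc.IH Suc.prems)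
  ultimately show ?case by (simp only: algebra_simps)
qed (simp add: germ_holomorphic_mult)

lemma mpow_Suc_subset: "mpow (Suc n) \<subseteq> mpow n"
  by (auto intro!: mpow_add mpow_mult)

lemma mpow_antimono: "m \<le> n \<Longrightarrow> mpow n \<subseteq> mpow m"
  by (rule lift_Suc_antimono_le[of mpow]) (rule mpow_Suc_subset)

lemma mpow_X_mult: "g \<in> mpow n \<Longrightarrow> germ_X * g \<in> mpow (Suc n)"
  using mpow_SucI[OF _ mpow_0, of g n] by simp

lemma mpow_Y_mult: "g \<in> mpow n \<Longrightarrow> germ_Y * g \<in> mpow (Suc n)"
  using mpow_SucI[OF mpow_0, of g n] by simp

lemma mpow_monom_mult:
  assumes "germ_holomorphic g"
  shows "germ_X ^ i * germ_Y ^ j * g \<in> mpow (i + j)"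
proof -
  have "germ_Y ^ j * g \<in> mpow j"
    by (induction j) (use assms in \<open>auto simp only: power_Suc mult.assoc power_0 mult_1 mpow.simps(1) mem_Collect_eq intro: mpow_Y_mult\<close>)
  hence "germ_X ^ i * (germ_Y ^ j * g) \<in> mpow (i + j)"
    by (induction i) (auto simp only: power_Suc mult.assoc power_0 mult_1 add_Suc add_0 intro: mpow_X_mult)
  thus ?thesis by (simp only: mult.assoc)
qed

lemma mpow_times: "g \<in> mpow m \<Longrightarrow> h \<in> mpow n \<Longrightarrow> g * h \<in> mpow (m + n)"
proof (induction m arbitrary: g)
  case (Suc m)
  obtain a b where "g = germ_X * a + germ_Y * b" "a \<in> mpow m" "b \<in> mpow m"
    using Suc.prems by (auto elim!: mpow_SucE)
  moreover from this have "germ_X * (a * h) + germ_Y * (b * h) \<in> mpow (Suc (m + n))"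
    by (intro mpow_SucI Suc.IH Suc.prems)
  ultimately show ?case by (simp add: algebra_simps del: mpow.simps)
qed (simp add: mpow_mult)

text \<open>Hadamard's lemma without its constant term says that X and Y generate the maximal
  ideal.\<close>

lemma max_ideal_eq_mpow: "max_ideal = mpow 1"
proof (intro equalityI subsetI)
  fix g assume g: "g \<in> max_ideal"
  hence hol: "germ_holomorphic g" and "germ_at0 g = 0" by (auto simp: max_ideal_def)
  hence "g = germ_X * germ_sx g + germ_Y * germ_sy (germ_restr g)"
    using germ_hadamard[of g] by (simp add: germ_const_simps)
  moreover have "\<dots> \<in> mpow (Suc 0)"
    using hol by (intro mpow_SucI) (auto intro: germ_holomorphic_intros germ_holomorphic_restr)
  ultimately show "g \<in> mpow 1" by simp
next
  fix g assume "g \<in> mpow 1"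
  thus "g \<in> max_ideal"
    using mpow_holomorphic[of g 1] by (auto simp: max_ideal_def germ_at0_simps)
qed

lemma ideal_prod_mpow_max_ideal: "ideal_prod O2 (mpow n) max_ideal = mpow (Suc n)"
proof (intro equalityI subsetI)
  fix g assume "g \<in> ideal_prod O2 (mpow n) max_ideal"
  thus "g \<in> mpow (Suc n)"
  proof induction
    case (prod i j)
    thus ?case using mpow_times[of i n j 1] by (simp add: max_ideal_eq_mpow del: mpow.simps)
  next
    case (sum s t)
    thus ?case using mpow_add by (simp del: mpow.simps)
  qed
next
  fix g assume "g \<in> mpow (Suc n)"
  then obtain a b where g: "g = germ_X * a + germ_Y * b" "a \<in> mpow n" "b \<in> mpow n"
    by (rule mpow_SucE)
  have XY: "germ_X \<in> max_ideal" "germ_Y \<in> max_ideal" by (auto simp: max_ideal_def)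
  have "a \<otimes>\<^bsub>O2\<^esub> germ_X \<oplus>\<^bsub>O2\<^esub> b \<otimes>\<^bsub>O2\<^esub> germ_Y \<in> ideal_prod O2 (mpow n) max_ideal"
    by (intro ideal_prod.intros g XY)
  thus "g \<in> ideal_prod O2 (mpow n) max_ideal" by (simp add: g mult.commute)
qed

lemma ideal_mpow: "ideal (mpow n) O2"
proof (induction n)
  case 0
  interpret cring O2 by (rule cring_O2)
  have "mpow 0 = carrier O2" by auto
  thus ?case using oneideal by simp
next
  case (Suc n)
  interpret cring O2 by (rule cring_O2)
  show ?case
    using ideal_prod_is_ideal[OF Suc ideal_max_ideal] by (simp only: ideal_prod_mpow_max_ideal)
qed

lemma max_ideal_power: "max_ideal [^]\<^bsub>ideals_set O2\<^esub> n = mpow n"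
proof (induction n)
  case 0
  have "mpow 0 = carrier O2" by auto
  thus ?case by (simp add: nat_pow_def ideals_set_def)
next
  case (Suc n)
  have "max_ideal [^]\<^bsub>ideals_set O2\<^esub> Suc n =
      ideal_prod O2 (max_ideal [^]\<^bsub>ideals_set O2\<^esub> n) max_ideal"
    by (simp add: nat_pow_def ideals_set_def)
  thus ?case by (simp only: Suc ideal_prod_mpow_max_ideal)
qed

text \<open>The n-th power of the maximal ideal is generated by the monomials of degree n.\<close>

lemma mpow_subset_ideal:
  assumes I: "ideal I O2" and monom: "\<And>i j. i + j = n \<Longrightarrow> germ_X ^ i * germ_Y ^ j \<in> I"
  shows "mpow n \<subseteq> I"
proof -
  \<comment> \<open>The prefix u collects the factors X and Y peeled off g, so that the induction on
    n goes through.\<close>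
  have "u * g \<in> I" if "g \<in> mpow n" "\<And>i j. i + j = n \<Longrightarrow> u * (germ_X ^ i * germ_Y ^ j) \<in> I" for u g
    using that
  proof (induction n arbitrary: u g)
    case 0
    thus ?case using 0(2)[of 0 0] by (auto intro: O2_idealD(6)[OF I])
  next
    case (Suc n)
    obtain a b where g: "g = germ_X * a + germ_Y * b" "a \<in> mpow n" "b \<in> mpow n"
      using Suc.prems(1) by (rule mpow_SucE)
    have "(u * germ_X) * a \<in> I"
    proof (rule Suc.IH[OF g(2)])
      show "u * germ_X * (germ_X ^ i * germ_Y ^ j) \<in> I" if "i + j = n" for i j
        using Suc.prems(2)[of "Suc i" j] that by (simp add: mult_ac)
    qed
    moreover have "(u * germ_Y) * b \<in> I"
    proof (rule Suc.IH[OF g(3)])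
      show "u * germ_Y * (germ_X ^ i * germ_Y ^ j) \<in> I" if "i + j = n" for i j
        using Suc.prems(2)[of i "Suc j"] that by (simp add: mult_ac)
    qed
    ultimately have "(u * germ_X) * a + (u * germ_Y) * b \<in> I"
      by (rule O2_idealD[OF I])
    thus ?case by (simp add: g algebra_simps)
  qed
  from this[of _ 1] show ?thesis using monom by auto
qed

text \<open>Each factor X or Y raises the order by one. This turns membership modulo a power of the
  maximal ideal into equations between coefficients, as the independence proofs require.\<close>

lemma germ_coeff_mpow:
  assumes "g \<in> mpow n" "i + j < n"
  shows "germ_coeff g i j = 0"
  using assms
proof (induction n arbitrary: g i j)
  case (Suc n)
  obtain a b where g: "g = germ_X * a + germ_Y * b" "a \<in> mpow n" "b \<in> mpow n"
    using Suc.prems(1) by (rule mpow_SucE)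
  have hol: "germ_holomorphic a" "germ_holomorphic b" using g mpow_holomorphic by auto
  have "germ_coeff g i j = germ_coeff (germ_X * a) i j + germ_coeff (germ_Y * b) i j"
    unfolding g(1) by (intro germ_coeff_add germ_holomorphic_mult hol germ_holomorphic_X germ_holomorphic_Y)
  moreover have "germ_coeff (germ_X * a) i j = 0"
    using Suc.prems(2) Suc.IH[OF g(2), of "i - 1" j] by (auto simp: germ_coeff_X_mult hol)
  moreover have "germ_coeff (germ_Y * b) i j = 0"
    using Suc.prems(2) Suc.IH[OF g(3), of i "j - 1"] by (auto simp: germ_coeff_Y_mult hol)
  ultimately show ?case by simp
qed simp

lemma germ_coeff_lincomb:
  assumes "finite S"
  shows "germ_coeff (\<Sum>s\<in>S. germ_const (c s) * (germ_X ^ fst s * germ_Y ^ snd s)) i j =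
           (if (i, j) \<in> S then c (i, j) else 0)"
proof -
  have hol: "germ_holomorphic (germ_X ^ a * germ_Y ^ b)" for a b
    by (intro germ_holomorphic_intros germ_holomorphic_X germ_holomorphic_Y)
  have monom: "germ_coeff (germ_X ^ a * germ_Y ^ b) i j = (if (i, j) = (a, b) then 1 else 0)" for a b
    using germ_coeff_monom_mult[OF germ_holomorphic_1, of a b i j] by (auto simp: germ_coeff_1)
  have "germ_coeff (\<Sum>s\<in>S. germ_const (c s) * (germ_X ^ fst s * germ_Y ^ snd s)) i j =
      (\<Sum>s\<in>S. germ_coeff (germ_const (c s) * (germ_X ^ fst s * germ_Y ^ snd s)) i j)"
    by (intro germ_coeff_sum germ_holomorphic_mult[OF germ_holomorphic_const hol])
  also have "\<dots> = (\<Sum>s\<in>S. if s = (i, j) then c s else 0)"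
    by (intro sum.cong) (auto simp: germ_coeff_const_mult hol monom)
  also have "\<dots> = (if (i, j) \<in> S then c (i, j) else 0)"
    using assms by simp
  finally show ?thesis .
qed

text \<open>The class of g lies in the complex span of the classes of the b s in O2/I, phrased
  without the quotient ring.\<close>

definition spanned :: "'i set \<Rightarrow> ('i \<Rightarrow> germ) \<Rightarrow> germ set \<Rightarrow> germ \<Rightarrow> bool" where
  "spanned S b I g \<longleftrightarrow> (\<exists>c. g - (\<Sum>s\<in>S. germ_const (c s) * b s) \<in> I)"

lemma spanned_add:
  assumes I: "ideal I O2" and "spanned S b I g" "spanned S b I h"
  shows "spanned S b I (g + h)"
proof -
  obtain c d where "g - (\<Sum>s\<in>S. germ_const (c s) * b s) \<in> I" "h - (\<Sum>s\<in>S. germ_const (d s) * b s) \<in> I"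
    using assms unfolding spanned_def by blast
  from O2_idealD(3)[OF I this] show ?thesis
    unfolding spanned_def
    by (intro exI[of _ "\<lambda>s. c s + d s"]) (simp add: germ_const_simps algebra_simps sum.distrib)
qed

lemma spanned_const_mult:
  assumes I: "ideal I O2" and "spanned S b I g"
  shows "spanned S b I (germ_const a * g)"
proof -
  obtain c where "g - (\<Sum>s\<in>S. germ_const (c s) * b s) \<in> I"
    using assms unfolding spanned_def by blast
  from O2_idealD(5)[OF I germ_holomorphic_const[of a] this] show ?thesis
    unfolding spanned_def
    by (intro exI[of _ "\<lambda>s. a * c s"]) (simp add: germ_const_simps algebra_simps sum_distrib_left)
qed

lemma spanned_uminus: "ideal I O2 \<Longrightarrow> spanned S b I g \<Longrightarrow> spanned S b I (- g)"
  using spanned_const_mult[of I S b g "-1"] by (simp add: germ_const_simps)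

lemma spanned_ideal: "g \<in> I \<Longrightarrow> spanned S b I g"
  unfolding spanned_def by (intro exI[of _ "\<lambda>_. 0"]) (simp add: germ_const_simps)

lemma spanned_base:
  assumes "ideal I O2" "finite S" "s \<in> S"
  shows "spanned S b I (b s)"
proof -
  have "(\<Sum>t\<in>S. germ_const (if t = s then 1 else 0) * b t) = (\<Sum>t\<in>S. if t = s then b t else 0)"
    by (intro sum.cong) (auto simp: germ_const_simps)
  also have "\<dots> = b s" using assms by simp
  finally show ?thesis
    unfolding spanned_def using O2_idealD(2)[OF assms(1)]
    by (intro exI[of _ "\<lambda>t. if t = s then 1 else 0"]) simp
qed

text \<open>Hadamard's lemma expands a germ into monomials until the degree reaches n, where
  everything lies in I.\<close>

lemma spanned_if_monomials_spanned:
  assumes I: "ideal I O2" and sub: "mpow n \<subseteq> I"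
    and monom: "\<And>i j. i + j < n \<Longrightarrow> spanned S b I (germ_X ^ i * germ_Y ^ j)"
    and g: "germ_holomorphic g"
  shows "spanned S b I g"
proof -
  \<comment> \<open>With a monomial in front, one expansion step yields a scalar multiple of that
    monomial and two terms of degree one higher, so n - (i + j) drops.\<close>
  have "spanned S b I (germ_X ^ i * germ_Y ^ j * g)" if "germ_holomorphic g" for i j g
    using that
  proof (induction "n - (i + j)" arbitrary: i j g rule: less_induct)
    case less
    show ?case
    proof (cases "i + j < n")
      case False
      hence "germ_X ^ i * germ_Y ^ j * g \<in> I"
        using mpow_monom_mult[OF less.prems, of i j] mpow_antimono[of n "i + j"] sub by auto
      thus ?thesis by (rule spanned_ideal)
    next
      case True
      define a h k where "a = germ_at0 g" and "h = germ_sx g" and "k = germ_sy (germ_restr g)"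
      have g: "g = germ_const a + germ_X * h + germ_Y * k"
        unfolding a_def h_def k_def by (rule germ_hadamard)
      have "spanned S b I (germ_const a * (germ_X ^ i * germ_Y ^ j)
          + germ_X ^ Suc i * germ_Y ^ j * h + germ_X ^ i * germ_Y ^ Suc j * k)"
        using True less.prems unfolding h_def k_def
        by (intro spanned_add[OF I] spanned_const_mult[OF I] monom less.hyps)
          (auto intro: germ_holomorphic_intros germ_holomorphic_restr)
      also have "germ_const a * (germ_X ^ i * germ_Y ^ j)
          + germ_X ^ Suc i * germ_Y ^ j * h + germ_X ^ i * germ_Y ^ Suc j * k
          = germ_X ^ i * germ_Y ^ j * g"
        unfolding g by (simp add: algebra_simps)
      finally show ?thesis .
    qed
  qed
  from this[OF g, of 0 0] show ?thesis by simp
qed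

section \<open>The dimension of a quotient of O2 over the constants, computed from a basis\<close>

lemma subfield_range_germ_const: "subfield (range germ_const) O2"
proof -
  interpret cring O2 by (rule cring_O2)
  have sub: "subring (range germ_const) O2"
  proof (rule subringI)
    show "range germ_const \<subseteq> carrier O2" by (auto intro: germ_holomorphic_const)
    show "\<one>\<^bsub>O2\<^esub> \<in> range germ_const" by (auto simp flip: germ_const_simps)
  next
    fix h assume "h \<in> range germ_const"
    then obtain c where "h = germ_const c" by blast
    hence "\<ominus>\<^bsub>O2\<^esub> h = germ_const (- c)"
      by (simp add: O2_a_inv germ_holomorphic_const germ_const_simps)
    thus "\<ominus>\<^bsub>O2\<^esub> h \<in> range germ_const" by simp
  qed (auto simp flip: germ_const_simps)
  show ?thesis
  proof (rule subfieldI)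
    show "subcring (range germ_const) O2" by (rule subcringI'[OF sub])
    have inv: "\<exists>d. germ_const d * germ_const c = 1" if "germ_const c \<noteq> 0" for c
    proof -
      have "c \<noteq> 0" using that germ_const_simps(1) by auto
      hence "germ_const (inverse c) * germ_const c = 1" by (simp flip: germ_const_simps)
      thus ?thesis ..
    qed
    show "Units (O2\<lparr>carrier := range germ_const\<rparr>) = range germ_const - {\<zero>\<^bsub>O2\<^esub>}"
    proof (intro equalityI subsetI)
      fix x assume "x \<in> Units (O2\<lparr>carrier := range germ_const\<rparr>)"
      thus "x \<in> range germ_const - {\<zero>\<^bsub>O2\<^esub>}" unfolding Units_def by (auto simp: O2_def)
    next
      fix x assume "x \<in> range germ_const - {\<zero>\<^bsub>O2\<^esub>}"
      then obtain c where c: "x = germ_const c" "germ_const c \<noteq> 0" by auto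
      then obtain d where "germ_const d * germ_const c = 1" using inv by blast
      moreover from this have "germ_const c * germ_const d = 1" by (simp add: mult.commute)
      ultimately show "x \<in> Units (O2\<lparr>carrier := range germ_const\<rparr>)"
        unfolding Units_def c by (auto simp: O2_def)
    qed
  qed
qed

lemma combine_O2:
  "distinct xs \<Longrightarrow> ring.combine O2 (map (\<lambda>s. germ_const (c s)) xs) (map b xs) =
     (\<Sum>s\<in>set xs. germ_const (c s) * b s)"
proof (induction xs)
  case Nil
  interpret cring O2 by (rule cring_O2)
  show ?case by simp
next
  case (Cons x xs)
  interpret cring O2 by (rule cring_O2)
  show ?case using Cons by simp
qed

text \<open>Turns a list of coefficients back into a function on the index set.\<close>

lemma ex_map_eq:
  assumes "distinct xs" "length ys = length xs"
  shows "\<exists>c. ys = map c xs"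
  using assms(2,1)
proof (induction ys xs rule: list_induct2)
  case (Cons y ys x xs)
  then obtain c where "ys = map c xs" by auto
  thus ?case using Cons.prems by (intro exI[of _ "c(x := y)"]) simp
qed simp

text \<open>A family that spans and is independent modulo I becomes a basis of O2/I. The proof
  passes from families over S to the lists on which the dimension is defined, by enumerating
  S.\<close>

lemma quotient_dim_eqI:
  assumes I: "ideal I O2" and S: "finite S" "S \<noteq> {}"
    and b: "\<And>s. s \<in> S \<Longrightarrow> germ_holomorphic (b s)"
    and span: "\<And>g. germ_holomorphic g \<Longrightarrow> spanned S b I g"
    and indep: "\<And>c s. (\<Sum>s\<in>S. germ_const (c s) * b s) \<in> I \<Longrightarrow> s \<in> S \<Longrightarrow> c s = 0"
  shows "quotient_dim I = card S"
proof -
  interpret I: ideal I O2 by fact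
  interpret h: ring_hom_ring O2 "O2 Quot I" "(+>\<^bsub>O2\<^esub>) I"
    by (rule I.rcos_ring_hom_ring)
  let ?h = "(+>\<^bsub>O2\<^esub>) I"
  define K where "K = ?h ` range germ_const"
  have zero_iff: "?h g = \<zero>\<^bsub>O2 Quot I\<^esub> \<longleftrightarrow> g \<in> I" if "germ_holomorphic g" for g
    using that I.rcos_const_imp_mem[of g] I.a_rcos_zero[OF I, of g] by (auto simp: FactRing_def)
  \<comment> \<open>The quotient must be nonzero for the image of the constants to be a field. If 1
    were in I, the sum of all b s would be too, against independence and S nonempty.\<close>
  have "\<one>\<^bsub>O2 Quot I\<^esub> \<noteq> \<zero>\<^bsub>O2 Quot I\<^esub>"
  proof
    assume "\<one>\<^bsub>O2 Quot I\<^esub> = \<zero>\<^bsub>O2 Quot I\<^esub>"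
    hence "1 \<in> I" using zero_iff[of 1] h.hom_one by (simp add: germ_holomorphic_1)
    have "(\<Sum>s\<in>S. germ_const 1 * b s) * 1 \<in> I"
      using b by (intro O2_idealD(5)[OF I _ \<open>1 \<in> I\<close>] germ_holomorphic_sum
          germ_holomorphic_mult germ_holomorphic_const)
    hence "(\<Sum>s\<in>S. germ_const 1 * b s) \<in> I" by simp
    from indep[OF this] S show False by auto
  qed
  hence K: "subfield K (O2 Quot I)"
    unfolding K_def by (rule h.img_is_subfield[OF subfield_range_germ_const])
  obtain xs where xs: "set xs = S" "distinct xs"
    using finite_distinct_list[OF S(1)] by blast
  define Us where "Us = map ?h (map b xs)"
  have bcarr: "set (map b xs) \<subseteq> carrier O2" using b xs by auto
  hence Us: "set Us \<subseteq> carrier (O2 Quot I)" unfolding Us_def using h.hom_closed by auto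
  have comb: "h.S.combine (map ?h (map (\<lambda>s. germ_const (c s)) xs)) Us =
      ?h (\<Sum>s\<in>S. germ_const (c s) * b s)" for c
  proof -
    have "set (map (\<lambda>s. germ_const (c s)) xs) \<subseteq> carrier O2"
      by (auto simp: germ_holomorphic_const)
    from h.combine_hom[OF this bcarr] show ?thesis
      unfolding Us_def combine_O2[OF xs(2)] xs(1) .
  qed
  have "h.S.independent K Us"
  proof (rule ccontr)
    assume "h.S.dependent K Us"
    then obtain Ks where Ks: "length Ks = length Us" "h.S.combine Ks Us = \<zero>\<^bsub>O2 Quot I\<^esub>"
      "set Ks \<subseteq> K" "set Ks \<noteq> {\<zero>\<^bsub>O2 Quot I\<^esub>}"
      by (rule h.S.dependent_imp_non_trivial_combine[OF K Us])
    \<comment> \<open>The scalars in K are classes of constants; choosing these constants turns the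
      relation in the quotient into a combination lying in I.\<close>
    have "\<exists>cs. Ks = map (\<lambda>c. ?h (germ_const c)) cs"
      using Ks(3) unfolding K_def image_image by (simp add: ex_map_conv) blast
    then obtain cs where cs: "Ks = map (\<lambda>c. ?h (germ_const c)) cs" by blast
    have "length cs = length xs" using Ks(1) by (simp add: cs Us_def)
    then obtain c where c: "cs = map c xs" using ex_map_eq[OF xs(2)] by blast
    have "?h (\<Sum>s\<in>S. germ_const (c s) * b s) = \<zero>\<^bsub>O2 Quot I\<^esub>"
      using Ks(2) comb[of c] by (simp add: cs c comp_def)
    hence "(\<Sum>s\<in>S. germ_const (c s) * b s) \<in> I"
      using b by (subst (asm) zero_iff) (auto intro!: germ_holomorphic_sum germ_holomorphic_mult germ_holomorphic_const)
    hence "c s = 0" if "s \<in> S" for s using indep that by blast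
    moreover have "?h 0 = \<zero>\<^bsub>O2 Quot I\<^esub>"
      using zero_iff[OF germ_holomorphic_0] O2_idealD(2)[OF I] by simp
    ultimately have "set Ks = {\<zero>\<^bsub>O2 Quot I\<^esub>}"
      using xs S by (auto simp: cs c germ_const_simps(1) image_constant_conv)
    thus False using Ks(4) by contradiction
  qed
  hence "h.S.dimension (length Us) K (h.S.Span K Us)"
    by (rule h.S.dimension_independent)
  moreover have "h.S.Span K Us = carrier (O2 Quot I)"
  proof (intro equalityI subsetI)
    fix v assume "v \<in> h.S.Span K Us"
    thus "v \<in> carrier (O2 Quot I)"
      using h.S.Span_in_carrier[OF _ Us] subringE(1)[OF subfieldE(1)[OF K]] by blast
  next
    fix v assume "v \<in> carrier (O2 Quot I)"
    then obtain g where g: "germ_holomorphic g" "v = ?h g"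
      by (auto simp: FactRing_def A_RCOSETS_def')
    obtain c where c: "g - (\<Sum>s\<in>S. germ_const (c s) * b s) \<in> I"
      using span[OF g(1)] unfolding spanned_def by blast
    define p where "p = (\<Sum>s\<in>S. germ_const (c s) * b s)"
    have p: "germ_holomorphic p"
      unfolding p_def using b by (intro germ_holomorphic_sum germ_holomorphic_mult germ_holomorphic_const)
    \<comment> \<open>Since g - p lies in I, the class of g is that of the combination p.\<close>
    have "?h g = ?h ((g - p) \<oplus>\<^bsub>O2\<^esub> p)" by simp
    also have "\<dots> = ?h (g - p) \<oplus>\<^bsub>O2 Quot I\<^esub> ?h p"
      using g p by (intro h.hom_add) (auto intro: germ_holomorphic_diff)
    also have "?h (g - p) = \<zero>\<^bsub>O2 Quot I\<^esub>"
      using c g p by (subst zero_iff) (auto simp: p_def[symmetric] intro: germ_holomorphic_diff)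
    finally have "v = ?h p" using g p h.hom_closed[of p] by simp
    also have "\<dots> = h.S.combine (map ?h (map (\<lambda>s. germ_const (c s)) xs)) Us"
      by (simp only: comb p_def)
    finally have v: "v = h.S.combine (map ?h (map (\<lambda>s. germ_const (c s)) xs)) Us" .
    have "set (map ?h (map (\<lambda>s. germ_const (c s)) xs)) \<subseteq> K"
      unfolding K_def by auto
    with v have "v \<in> {h.S.combine Ks Us | Ks. set Ks \<subseteq> K}" by blast
    thus "v \<in> h.S.Span K Us"
      by (simp only: h.S.Span_eq_combine_set[OF K Us])
  qed
  ultimately have "h.S.dim K (carrier (O2 Quot I)) = length Us"
    using h.S.dimI[OF K] by (simp add: over_def)
  moreover have "K = range (\<lambda>c. I +>\<^bsub>O2\<^esub> germ_const c)"
    unfolding K_def by (simp add: image_image)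
  ultimately show ?thesis
    using distinct_card[OF xs(2)] by (simp add: quotient_dim_def Us_def xs(1))
qed

section \<open>The germ of \<open>x\<^sup>5 + y\<^sup>5 + x\<^sup>3 y\<^sup>3\<close>\<close>

lemma germ_of_simps:
  "germ_of F + germ_of G = germ_of (\<lambda>p. F p + G p)"
  "germ_of F * germ_of G = germ_of (\<lambda>p. F p * G p)"
  by (transfer; simp)+

lemma germ_of_power: "germ_of F ^ n = germ_of (\<lambda>p. F p ^ n)"
proof (induction n)
  case 0
  show ?case by (simp add: one_germ_def germ_of_def)
qed (simp add: germ_of_simps)

lemma germ_const_of_nat: "germ_const (of_nat n) = of_nat n"
  by (induction n) (simp_all add: germ_const_simps)

lemma germ_const_numeral: "germ_const (numeral n) = numeral n"
  using germ_const_of_nat[of "numeral n"] by simp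

lemma germ_holomorphic_numeral: "germ_holomorphic (numeral n)"
  using germ_holomorphic_const[of "numeral n"] by (simp add: germ_const_numeral)

lemma germ_at0_numeral: "germ_at0 (numeral n) = numeral n"
  using germ_at0_X_Y_const(3)[of "numeral n"] by (simp add: germ_const_numeral)

lemma germ_at0_power: "germ_at0 (g ^ n) = germ_at0 g ^ n"
  by (induction n) (simp_all add: germ_at0_simps)

definition fpoly :: germ where
  "fpoly = germ_X ^ 5 + germ_Y ^ 5 + germ_X ^ 3 * germ_Y ^ 3"

lemma germ_X_Y_eq: "germ_X = germ_of fst" "germ_Y = germ_of snd"
  by (transfer; simp)+

lemma fpoly_eq: "fpoly = germ_of (\<lambda>(x, y). x ^ 5 + y ^ 5 + x ^ 3 * y ^ 3)"
  unfolding fpoly_def germ_X_Y_eq germ_of_power germ_of_simps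
  by (simp add: split_beta')

lemma germ_holomorphic_fpoly: "germ_holomorphic fpoly"
  unfolding fpoly_def
  by (intro germ_holomorphic_intros germ_holomorphic_X germ_holomorphic_Y)

lemma pderiv_fpoly:
  "pderiv_x (\<lambda>(x, y). x ^ 5 + y ^ 5 + x ^ 3 * y ^ 3) = (\<lambda>p. 5 * fst p ^ 4 + 3 * fst p ^ 2 * snd p ^ 3)"
  "pderiv_y (\<lambda>(x, y). x ^ 5 + y ^ 5 + x ^ 3 * y ^ 3) = (\<lambda>p. 5 * snd p ^ 4 + 3 * fst p ^ 3 * snd p ^ 2)"
  unfolding pderiv_x_def pderiv_y_def
  by (auto intro!: ext DERIV_imp_deriv derivative_eq_intros)

lemma germ_dx_fpoly: "germ_dx fpoly = 5 * germ_X ^ 4 + 3 * germ_X ^ 2 * germ_Y ^ 3"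
  and germ_dy_fpoly: "germ_dy fpoly = 5 * germ_Y ^ 4 + 3 * germ_X ^ 3 * germ_Y ^ 2"
proof -
  have "germ_dx (germ_of F) = germ_of (pderiv_x F)" "germ_dy (germ_of F) = germ_of (pderiv_y F)" for F
    by (transfer, simp)+
  thus "germ_dx fpoly = 5 * germ_X ^ 4 + 3 * germ_X ^ 2 * germ_Y ^ 3"
    "germ_dy fpoly = 5 * germ_Y ^ 4 + 3 * germ_X ^ 3 * germ_Y ^ 2"
    by (simp_all only: fpoly_eq pderiv_fpoly germ_X_Y_eq germ_of_power germ_const_numeral[symmetric]
      germ_const_def germ_of_simps)
qed

text \<open>Already the two partial derivatives have no common zero in the unit ball except
  0.\<close>

lemma isolated_singularity_fpoly: "isolated_singularity fpoly"
proof -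
  have "isolated_singular_locus fpoly"
    unfolding fpoly_eq
  proof transfer
    have "eventually (\<lambda>p. p \<in> ball 0 1) (nhds (0 :: complex \<times> complex))"
      by (intro eventually_nhds_in_open) auto
    hence "eventually (\<lambda>p. p \<in> ball 0 1) (at (0 :: complex \<times> complex))"
      by (simp add: eventually_nhds_conv_at)
    moreover have "eventually (\<lambda>p. p \<noteq> 0) (at (0 :: complex \<times> complex))"
      by (simp add: eventually_at_filter)
    ultimately show "\<forall>\<^sub>F p in at 0. \<not> ((case p of (x, y) \<Rightarrow> x ^ 5 + y ^ 5 + x ^ 3 * y ^ 3) = (0::complex) \<and>
        pderiv_x (\<lambda>(x, y). x ^ 5 + y ^ 5 + x ^ 3 * y ^ 3) p = 0 \<and>
        pderiv_y (\<lambda>(x, y). x ^ 5 + y ^ 5 + x ^ 3 * y ^ 3) p = 0)"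
    proof eventually_elim
      case (elim p)
      obtain x y where p: "p = (x, y)" by (cases p)
      have small: "norm x < 1" "norm y < 1"
        using elim(1) norm_fst_le[of x y] norm_snd_le[of y x] by (auto simp: p)
      show ?case
      proof
        assume "(case p of (x, y) \<Rightarrow> x ^ 5 + y ^ 5 + x ^ 3 * y ^ 3) = 0 \<and>
          pderiv_x (\<lambda>(x, y). x ^ 5 + y ^ 5 + x ^ 3 * y ^ 3) p = 0 \<and>
          pderiv_y (\<lambda>(x, y). x ^ 5 + y ^ 5 + x ^ 3 * y ^ 3) p = 0"
        hence "5 * x ^ 4 + 3 * x ^ 2 * y ^ 3 = 0" "5 * y ^ 4 + 3 * x ^ 3 * y ^ 2 = 0"
          by (simp_all add: pderiv_fpoly p)
        hence e: "x ^ 2 * (5 * x ^ 2 + 3 * y ^ 3) = 0" "y ^ 2 * (5 * y ^ 2 + 3 * x ^ 3) = 0"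
          by (simp_all add: algebra_simps power_add[symmetric] flip: power_add)
        \<comment> \<open>If u is nonzero, 5 u^2 = -3 v^3, and one factor |v| is below 1. Used for
          (x, y) and (y, x), the two bounds force both coordinates to be 0.\<close>
        have le: "5 * norm u ^ 2 \<le> 3 * norm v ^ 2"
          if "u ^ 2 * (5 * u ^ 2 + 3 * v ^ 3) = 0" "norm v < 1" for u v :: complex
        proof (cases "u = 0")
          case False
          hence "5 * u ^ 2 = - (3 * v ^ 3)" using that by (simp add: eq_neg_iff_add_eq_0)
          hence "norm (5 * u ^ 2) = norm (3 * v ^ 3)" by simp
          hence "5 * norm u ^ 2 = 3 * (norm v ^ 2 * norm v)"
            by (simp add: norm_mult norm_power power3_eq_cube power2_eq_square)
          also have "\<dots> \<le> 3 * (norm v ^ 2 * 1)"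
            using that(2) by (intro mult_left_mono) auto
          finally show ?thesis by simp
        qed simp
        have "5 * norm x ^ 2 \<le> 3 * norm y ^ 2" "5 * norm y ^ 2 \<le> 3 * norm x ^ 2"
          using le e small by auto
        hence "norm x ^ 2 \<le> 0" "norm y ^ 2 \<le> 0"
          using zero_le_power2[of "norm x"] zero_le_power2[of "norm y"] by linarith+
        hence "p = 0" by (simp add: p zero_prod_def)
        thus False using elim by simp
      qed
    qed
  qed
  moreover have "germ_at0 fpoly = 0" "germ_at0 (germ_dx fpoly) = 0" "germ_at0 (germ_dy fpoly) = 0"
    unfolding germ_dx_fpoly germ_dy_fpoly unfolding fpoly_def
    by (simp_all add: germ_at0_simps germ_at0_power)
  ultimately show ?thesis
    unfolding isolated_singularity_def by (simp add: O2_def germ_holomorphic_fpoly)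
qed

section \<open>The eighth Milnor ideal and its colength\<close>

lemma milnor_ideal_fpoly: "milnor_ideal 8 fpoly = mpow 12"
proof -
  interpret cring O2 by (rule cring_O2)
  define u where "u = 5 * germ_X ^ 4 + 3 * germ_X ^ 2 * germ_Y ^ 3"
  define v where "v = 5 * germ_Y ^ 4 + 3 * germ_X ^ 3 * germ_Y ^ 2"
  define J where "J = jacobian_ideal fpoly"
  have J_eq: "J = genideal O2 {u, v}"
    unfolding J_def jacobian_ideal_def germ_dx_fpoly germ_dy_fpoly u_def v_def ..
  have hol: "germ_holomorphic (germ_X ^ i * germ_Y ^ j)" for i j
    by (intro germ_holomorphic_intros germ_holomorphic_X germ_holomorphic_Y)
  have monom: "germ_X ^ i * germ_Y ^ j \<in> mpow n" if "n \<le> i + j" for i j n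
    using mpow_monom_mult[OF germ_holomorphic_1, of i j] mpow_antimono[OF that] by auto
  have uv: "u \<in> mpow 4" "v \<in> mpow 4"
    unfolding u_def v_def mult.assoc
    using monom[of 4 4 0] monom[of 4 0 4] monom[of 4 2 3] monom[of 4 3 2]
    by (auto intro!: mpow_add mpow_mult simp: germ_holomorphic_numeral)
  have J: "ideal J O2" "u \<in> J" "v \<in> J" "J \<subseteq> mpow 4"
    unfolding J_eq using uv genideal_self[of "{u, v}"] genideal_minimal[OF ideal_mpow, of "{u, v}" 4]
    by (auto intro!: genideal_ideal dest: mpow_holomorphic)
  define I where "I = milnor_ideal 8 fpoly"
  have I_eq: "I = ideal_prod O2 (mpow 8) J"
    by (simp add: I_def milnor_ideal_def max_ideal_power J_def)
  have I: "ideal I O2"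
    unfolding I_eq by (rule ideal_prod_is_ideal[OF ideal_mpow J(1)])
  have prodI: "germ_X ^ i * germ_Y ^ j * w \<in> I" if "8 \<le> i + j" "w \<in> J" for i j w
    using ideal_prod.prod[of _ "mpow 8" w J O2, OF monom[OF that(1)] that(2)] by (simp add: I_eq)
  have num: "numeral n * g \<in> I" if "g \<in> I" for g n
    by (rule O2_idealD(5)[OF I germ_holomorphic_numeral that])
  \<comment> \<open>The factor 25 - 9xy has value 25 at the origin, hence is invertible and can be
    cancelled.\<close>
  have unit: "germ_X ^ i * germ_Y ^ j \<in> I"
    if "(25 - 9 * germ_X * germ_Y) * (germ_X ^ i * germ_Y ^ j) \<in> I" for i j
  proof (rule O2_unit_mult_mem_ideal[OF I _ _ hol that])
    show "germ_holomorphic (25 - 9 * germ_X * germ_Y)"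
      by (intro germ_holomorphic_intros germ_holomorphic_numeral germ_holomorphic_X germ_holomorphic_Y)
    have "germ_at0 (25 + - (9 * germ_X * germ_Y)) \<noteq> 0"
      unfolding germ_at0_simps germ_at0_numeral germ_at0_X_Y_const by simp
    thus "germ_at0 (25 - 9 * germ_X * germ_Y) \<noteq> 0" by simp
  qed
  have 1: "germ_X ^ i * germ_Y ^ j \<in> I" if ij: "4 \<le> i" "1 \<le> j" "12 \<le> i + j" for i j
  proof -
    obtain a b where ab: "i = 4 + a" "j = 1 + b" using ij by (metis le_iff_add)
    \<comment> \<open>The combination cancels the terms 15 x^(a+2) y^(b+4). From i + j >= 12 the
      multipliers have degrees a + b + 1 >= 8 and a + b + 2 >= 9, so they lie in the eighth power of
      the maximal ideal.\<close>
    have "5 * (germ_X ^ a * germ_Y ^ (1 + b) * u) - 3 * (germ_X ^ (2 + a) * germ_Y ^ b * v) \<in> I"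
      using ij by (intro O2_idealD(4)[OF I] num prodI J) (auto simp: ab)
    also have "5 * (germ_X ^ a * germ_Y ^ (1 + b) * u) - 3 * (germ_X ^ (2 + a) * germ_Y ^ b * v) =
        (25 - 9 * germ_X * germ_Y) * (germ_X ^ i * germ_Y ^ j)"
      unfolding u_def v_def ab by (simp add: algebra_simps power_add eval_nat_numeral)
    finally show ?thesis by (rule unit)
  qed
  have 2: "germ_X ^ i * germ_Y ^ j \<in> I" if ij: "1 \<le> i" "4 \<le> j" "12 \<le> i + j" for i j
  proof -
    obtain a b where ab: "i = 1 + a" "j = 4 + b" using ij by (metis le_iff_add)
    have "5 * (germ_X ^ (1 + a) * germ_Y ^ b * v) - 3 * (germ_X ^ a * germ_Y ^ (2 + b) * u) \<in> I"
      using ij by (intro O2_idealD(4)[OF I] num prodI J) (auto simp: ab)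
    also have "5 * (germ_X ^ (1 + a) * germ_Y ^ b * v) - 3 * (germ_X ^ a * germ_Y ^ (2 + b) * u) =
        (25 - 9 * germ_X * germ_Y) * (germ_X ^ i * germ_Y ^ j)"
      unfolding u_def v_def ab by (simp add: algebra_simps power_add eval_nat_numeral)
    finally show ?thesis by (rule unit)
  qed
  have five: "g \<in> I" if "5 * g \<in> I" "germ_holomorphic g" for g
    by (rule O2_unit_mult_mem_ideal[OF I germ_holomorphic_numeral _ that(2,1)]) (simp add: germ_at0_numeral)
  \<comment> \<open>The pure power has no factor y for the previous relation. Instead x^8 f_x = 5
    x^12 + 3 x^10 y^3, whose last monomial is covered by 1.\<close>
  have 3: "germ_X ^ 12 * germ_Y ^ 0 \<in> I"
  proof (rule five[OF _ hol])
    have "germ_X ^ 8 * germ_Y ^ 0 * u - 3 * (germ_X ^ 10 * germ_Y ^ 3) \<in> I"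
      by (intro O2_idealD(4)[OF I] prodI num J 1) auto
    also have "germ_X ^ 8 * germ_Y ^ 0 * u - 3 * (germ_X ^ 10 * germ_Y ^ 3) = 5 * (germ_X ^ 12 * germ_Y ^ 0)"
      unfolding u_def by (simp add: algebra_simps eval_nat_numeral)
    finally show "5 * (germ_X ^ 12 * germ_Y ^ 0) \<in> I" .
  qed
  have 4: "germ_X ^ 0 * germ_Y ^ 12 \<in> I"
  proof (rule five[OF _ hol])
    have "germ_X ^ 0 * germ_Y ^ 8 * v - 3 * (germ_X ^ 3 * germ_Y ^ 10) \<in> I"
      by (intro O2_idealD(4)[OF I] prodI num J 2) auto
    also have "germ_X ^ 0 * germ_Y ^ 8 * v - 3 * (germ_X ^ 3 * germ_Y ^ 10) = 5 * (germ_X ^ 0 * germ_Y ^ 12)"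
      unfolding v_def by (simp add: algebra_simps eval_nat_numeral)
    finally show "5 * (germ_X ^ 0 * germ_Y ^ 12) \<in> I" .
  qed
  have "mpow 12 \<subseteq> I"
  proof (rule mpow_subset_ideal[OF I])
    fix i j :: nat assume ij: "i + j = 12"
    \<comment> \<open>If both exponents are positive and add up to 12, one of them is at least 6,
      hence at least 4.\<close>
    then consider "j = 0" "i = 12" | "i = 0" "j = 12" | "4 \<le> i" "1 \<le> j" | "1 \<le> i" "4 \<le> j"
      by linarith
    thus "germ_X ^ i * germ_Y ^ j \<in> I"
      by cases (use 1 2 3 4 ij in auto)
  qed
  moreover have "I \<subseteq> mpow 12"
  proof
    fix g assume "g \<in> I"
    thus "g \<in> mpow 12"
      unfolding I_eq
    proof induction
      case (prod i j)
      \<comment> \<open>Both partial derivatives have order 4, and 8 + 4 = 12.\<close>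
      thus ?case using mpow_times[of i 8 j 4] J(4) by auto
    next
      case (sum s t)
      thus ?case using mpow_add[of s 12 t] by simp
    qed
  qed
  ultimately show ?thesis by (simp add: I_def)
qed

lemma quotient_dim_mpow:
  assumes "n > 0"
  shows "quotient_dim (mpow n) = card (SIGMA i:{..<n}. {..<n - i})"
proof (rule quotient_dim_eqI[OF ideal_mpow, where b = "\<lambda>s. germ_X ^ fst s * germ_Y ^ snd s"])
  let ?S = "SIGMA i:{..<n}. {..<n - i}"
  show fin: "finite ?S" by simp
  have "(0, 0) \<in> ?S" using assms by simp
  thus "?S \<noteq> {}" by blast
  show "germ_holomorphic (germ_X ^ fst s * germ_Y ^ snd s)" for s
    by (intro germ_holomorphic_intros germ_holomorphic_X germ_holomorphic_Y)
  show "spanned ?S (\<lambda>s. germ_X ^ fst s * germ_Y ^ snd s) (mpow n) g" if "germ_holomorphic g" for g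
  proof (rule spanned_if_monomials_spanned[OF ideal_mpow order_refl _ that])
    fix i j :: nat assume "i + j < n"
    thus "spanned ?S (\<lambda>s. germ_X ^ fst s * germ_Y ^ snd s) (mpow n) (germ_X ^ i * germ_Y ^ j)"
      using spanned_base[OF ideal_mpow fin, of "(i, j)" "\<lambda>s. germ_X ^ fst s * germ_Y ^ snd s"] by simp
  qed
  fix c s
  assume "(\<Sum>s\<in>?S. germ_const (c s) * (germ_X ^ fst s * germ_Y ^ snd s)) \<in> mpow n" and s: "s \<in> ?S"
  hence "germ_coeff (\<Sum>s\<in>?S. germ_const (c s) * (germ_X ^ fst s * germ_Y ^ snd s)) (fst s) (snd s) = 0"
    by (intro germ_coeff_mpow) auto
  thus "c s = 0" using s by (subst (asm) germ_coeff_lincomb) (auto simp: fin)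
qed

section \<open>The eighth Tjurina ideal and its colength\<close>

lemma tjurina_ideal_fpoly: "tjurina_ideal 8 fpoly = {r + h * fpoly | r h. r \<in> mpow 12 \<and> germ_holomorphic h}"
proof -
  interpret cring O2 by (rule cring_O2)
  have "genideal O2 {fpoly} = {h * fpoly | h. germ_holomorphic h}"
    using cgenideal_eq_genideal[of fpoly] by (simp add: cgenideal_def germ_holomorphic_fpoly)
  thus ?thesis
    unfolding tjurina_ideal_def milnor_ideal_fpoly set_add_def' by auto
qed

lemma ideal_tjurina_ideal_fpoly: "ideal (tjurina_ideal 8 fpoly) O2"
proof -
  interpret cring O2 by (rule cring_O2)
  show ?thesis
    unfolding tjurina_ideal_def milnor_ideal_fpoly
    by (intro add_ideals ideal_mpow genideal_ideal) (simp add: germ_holomorphic_fpoly)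
qed

lemma germ_coeff_mult_fpoly:
  assumes h: "germ_holomorphic h"
  shows "germ_coeff (h * fpoly) i j =
           (if 5 \<le> i then germ_coeff h (i - 5) j else 0) + (if 5 \<le> j then germ_coeff h i (j - 5) else 0)
           + (if 3 \<le> i \<and> 3 \<le> j then germ_coeff h (i - 3) (j - 3) else 0)"
proof -
  have "h * fpoly = germ_X ^ 5 * germ_Y ^ 0 * h + germ_X ^ 0 * germ_Y ^ 5 * h + germ_X ^ 3 * germ_Y ^ 3 * h"
    by (simp add: fpoly_def algebra_simps)
  moreover have "germ_holomorphic (germ_X ^ a * germ_Y ^ b * h)" for a b
    by (intro germ_holomorphic_intros germ_holomorphic_X germ_holomorphic_Y h)
  ultimately show ?thesis
    by (simp only: germ_coeff_add germ_holomorphic_add germ_coeff_monom_mult[OF h]) simp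
qed

text \<open>The basis consists of the monomials x^i y^j with i < 5 and i + j < 12: x^5 is the
  leading term for rewriting modulo f.\<close>

lemma quotient_dim_tjurina_ideal_fpoly:
  "quotient_dim (tjurina_ideal 8 fpoly) = card (SIGMA i:{..<5::nat}. {..<12 - i})"
proof (rule quotient_dim_eqI[OF ideal_tjurina_ideal_fpoly, where b = "\<lambda>s. germ_X ^ fst s * germ_Y ^ snd s"])
  let ?S = "SIGMA i:{..<5::nat}. {..<12 - i}" and ?b = "\<lambda>s. germ_X ^ fst s * germ_Y ^ snd s"
  let ?T = "tjurina_ideal 8 fpoly"
  note T = ideal_tjurina_ideal_fpoly
  have sub: "mpow 12 \<subseteq> ?T"
  proof
    fix r assume "r \<in> mpow 12"
    moreover have "r = r + 0 * fpoly" by simp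
    ultimately show "r \<in> ?T"
      unfolding tjurina_ideal_fpoly using germ_holomorphic_0 by blast
  qed
  have fT: "h * fpoly \<in> ?T" if "germ_holomorphic h" for h
  proof -
    have "h * fpoly = 0 + h * fpoly" by simp
    thus ?thesis
      unfolding tjurina_ideal_fpoly using that mpow_0 by blast
  qed
  show fin: "finite ?S" by simp
  have "(0, 0) \<in> ?S" by simp
  thus "?S \<noteq> {}" by blast
  have hol: "germ_holomorphic (germ_X ^ i * germ_Y ^ j)" for i j
    by (intro germ_holomorphic_intros germ_holomorphic_X germ_holomorphic_Y)
  show "germ_holomorphic (?b s)" for s by (rule hol)
  have monom: "spanned ?S ?b ?T (germ_X ^ i * germ_Y ^ j)" for i j
  proof (induction i arbitrary: j rule: less_induct)
    case (less i)
    consider "12 \<le> i + j" | "i < 5" "i + j < 12" | "5 \<le> i" by linarith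
    thus ?case
    proof cases
      case 1
      hence "germ_X ^ i * germ_Y ^ j \<in> mpow 12"
        using mpow_monom_mult[OF germ_holomorphic_1, of i j] mpow_antimono[of 12 "i + j"] by auto
      thus ?thesis using sub by (intro spanned_ideal) auto
    next
      case 2
      thus ?thesis using spanned_base[OF T fin, of "(i, j)" ?b] by auto
    next
      case 3
      then obtain k where k: "i = 5 + k" by (auto simp: le_iff_add)
      \<comment> \<open>Multiplying f by x^k y^j replaces x^(k+5) y^j by monomials with x-exponents
        k and k + 3, both below i, so induction on the x-exponent terminates.\<close>
      have "spanned ?S ?b ?T (germ_X ^ k * germ_Y ^ j * fpoly
          + - (germ_X ^ k * germ_Y ^ (j + 5)) + - (germ_X ^ (k + 3) * germ_Y ^ (j + 3)))"
        by (intro spanned_add[OF T] spanned_uminus[OF T] less.IH spanned_ideal fT hol) (auto simp: k)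
      also have "germ_X ^ k * germ_Y ^ j * fpoly
          + - (germ_X ^ k * germ_Y ^ (j + 5)) + - (germ_X ^ (k + 3) * germ_Y ^ (j + 3)) =
          germ_X ^ i * germ_Y ^ j"
        unfolding fpoly_def k by (simp add: algebra_simps power_add)
      finally show ?thesis .
    qed
  qed
  show "spanned ?S ?b ?T g" if "germ_holomorphic g" for g
    by (rule spanned_if_monomials_spanned[OF T sub monom that])
  fix c s
  assume "(\<Sum>s\<in>?S. germ_const (c s) * ?b s) \<in> ?T" and s: "s \<in> ?S"
  then obtain r h where rh: "(\<Sum>s\<in>?S. germ_const (c s) * ?b s) = r + h * fpoly"
    "r \<in> mpow 12" "germ_holomorphic h"
    unfolding tjurina_ideal_fpoly by blast
  define q where "q = germ_coeff h"
  \<comment> \<open>Comparison of coefficients below degree 12, where the remainder r contributes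
    nothing.\<close>
  have eq: "(if (i, j) \<in> ?S then c (i, j) else 0) =
      (if 5 \<le> i then q (i - 5) j else 0) + (if 5 \<le> j then q i (j - 5) else 0)
      + (if 3 \<le> i \<and> 3 \<le> j then q (i - 3) (j - 3) else 0)" if "i + j < 12" for i j
  proof -
    have "(if (i, j) \<in> ?S then c (i, j) else 0) = germ_coeff (r + h * fpoly) i j"
      using germ_coeff_lincomb[OF fin, of c i j] by (simp only: rh)
    also have "\<dots> = germ_coeff r i j + germ_coeff (h * fpoly) i j"
      by (intro germ_coeff_add mpow_holomorphic[OF rh(2)] germ_holomorphic_mult germ_holomorphic_fpoly rh)
    also have "germ_coeff r i j = 0" by (rule germ_coeff_mpow[OF rh(2) that])
    finally show ?thesis by (simp add: germ_coeff_mult_fpoly[OF rh(3)] q_def)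
  qed
  \<comment> \<open>At (i + 5, j), of degree below 12, the left side vanishes because the x-exponent
    is at least 5. The other terms are values of q at second index j - 5 or j - 3 and total index at
    most i + j, so they vanish by induction on j.\<close>
  have q0: "q i j = 0" if "i + j < 7" for i j
    using that
  proof (induction j arbitrary: i rule: less_induct)
    case (less j)
    show ?case
      using eq[of "i + 5" j] less.prems less.IH[of "j - 5" "i + 5"] less.IH[of "j - 3" "i + 2"]
      by (auto split: if_splits)
  qed
  show "c s = 0"
    \<comment> \<open>For s in the index set the x-exponent is below 5, so only values of q at total
      index below 7 remain on the right.\<close>
    using eq[of "fst s" "snd s"] s by (auto simp: q0 split: if_splits)
qed

section \<open>The counterexample with k = 8\<close>

theorem mainTheorem6:
  fixes f :: germ
  defines "f \<equiv> germ_of (\<lambda>(x, y). x ^ 5 + y ^ 5 + x ^ 3 * y ^ 3)"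
  shows "\<not> (\<forall>g. isolated_singularity g \<longrightarrow>
             (\<forall>k. real (milnor_number k g) / real (tjurina_number k g) < 4 / 3)) \<and>
         isolated_singularity f \<and>
         milnor_number 8 f = 78 \<and>
         tjurina_number 8 f = 50 \<and>
         real (milnor_number 8 f) / real (tjurina_number 8 f) = 78 / 50 \<and>
         (78 / 50 :: real) > 4 / 3"
proof -
  have f: "f = fpoly" unfolding f_def by (rule fpoly_eq[symmetric])
  have 1: "isolated_singularity f" unfolding f by (rule isolated_singularity_fpoly)
  \<comment> \<open>The rows of the index triangle add up to 12 + 11 + ... + 1 = 78.\<close>
  have 2: "milnor_number 8 f = 78"
    by (simp add: milnor_number_def f milnor_ideal_fpoly quotient_dim_mpow lessThan_nat_numeral)
  \<comment> \<open>Only the first five rows remain: 12 + 11 + 10 + 9 + 8 = 50.\<close>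
  have 3: "tjurina_number 8 f = 50"
    by (simp add: tjurina_number_def f quotient_dim_tjurina_ideal_fpoly lessThan_nat_numeral)
  have "\<not> real (milnor_number 8 f) / real (tjurina_number 8 f) < 4 / 3"
    by (simp add: 2 3)
  hence 4: "\<not> (\<forall>g. isolated_singularity g \<longrightarrow>
             (\<forall>k. real (milnor_number k g) / real (tjurina_number k g) < 4 / 3))"
    using 1 by blast
  show ?thesis
    using 4 1 2 3 by simp
qed

end
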